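(* $\mathcal{L}(C_2 \oplus C_4) = \mathcal{L}_1 \cup \mathcal{L}_2 \cup \mathcal{L}_3 \cup \mathcal{L}_4 \cup \mathcal{L}_5$, where \begin{align*} \mathcal{L}_1 &= \{ \{y\} \mid y \in \mathbb{N}_0 \},\\ \mathcal{L}_2 &= \{ y + 2\lceil k/3 \rceil + [0,k] \mid y \in \mathbb{N}_0,\ k \in \mathbb{N} \setminus \{3\} \} \cup \{ y + [3,6] \mid y \in \mathbb{N}_0 \} \cup \{ [2t+1, 5t+2] \mid t \in \mathbb{N} \}\\ &= \{ y + \lceil 2k/3 \rceil + [0,k] \mid y \in \mathbb{N}_0,\ k \in \mathbb{N} \setminus \{1,3\} \} \cup \{ y + 3 + [0,3],\ y + 2 + [0,1] \mid y \in \mathbb{N}_0 \},\\ \mathcal{L}_3 &= \{ y + 2k + 2 \cdot [0,k] \mid y \in \mathbb{N}_0,\ k \in \mathbb{N} \},\\ \mathcal{L}_4 &= \{ y + k + 1 + (\{0\} \cup [2,k+2]) \mid y \in \mathbb{N}_0,\ k \in \mathbb{N} \text{ odd} \},\\ \mathcal{L}_5 &= \{ y + k + 2 + ([0,k] \cup \{k+2\}) \mid y \in \mathbb{N}_0,\ k \in \mathbb{N} \}. \end{align*}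
   Context: $\mathbb{N}$ is the set of positive integers and $\mathbb{N}_0 = \mathbb{N} \cup \{0\}$. For integers $a \le b$, $[a,b] = \{x \in \mathbb{Z} \mid a \le x \le b\}$. For $A, B \subset \mathbb{Z}$ and $m \in \mathbb{Z}$: $A + B = \{a+b \mid a \in A, b \in B\}$, $m + A = \{m\} + A$, and $m \cdot A = \{ma \mid a \in A\}$ (dilation; it binds more tightly than $+$). $C_n$ is the cyclic group of order $n$. For an additive abelian group $G$, let $\mathcal{F}(G)$ be the free abelian monoid (written multiplicatively) with basis $G$; its elements are called sequences over $G$: $S = g_1 \cdots g_\ell$, i.e. finite multisets of elements of $G$, with sum $\sigma(S) = g_1 + \dots + g_\ell$. $\mathcal{B}(G) = \{S \in \mathcal{F}(G) \mid \sigma(S) = 0\}$ is the monoid of zero-sum sequences over $G$; its identity is the empty sequence. An atom (irreducible element) of $\mathcal{B}(G)$ is a nonempty zero-sum sequence which is not a product of two nonempty zero-sum sequences; note the sequence consisting of the single term $0$ is an atom. For a nonempty $A \in \mathcal{B}(G)$, its set of lengths $\mathsf{L}(A)$ is the set of all $k \in \mathbb{N}$ such that $A$ is a product of $k$ atoms; for the empty sequence, $\mathsf{L} = \{0\}$. $\mathcal{L}(G) = \{ \mathsf{L}(A) \mid A \in \mathcal{B}(G) \}$ is the system of sets of lengths. *)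

theory Defs
  imports Complex_Main "HOL-Library.Multiset" "HOL-Library.Numeral_Type"
    "HOL-Library.Product_Plus" "HOL-Library.Set_Algebras"
begin

text \<open>
  Sequences over an additive abelian group are finite multisets of group elements: the
  product of sequences is \<open>+\<close> on multisets, and the sum of a sequence is \<^const>\<open>sum_mset\<close>.
\<close>

definition zero_sum_sequences :: "'g::ab_group_add multiset set" where
  "zero_sum_sequences = {S. \<Sum>\<^sub># S = 0}"

definition zero_sum_atoms :: "'g::ab_group_add multiset set" where
  "zero_sum_atoms = {U \<in> zero_sum_sequences. U \<noteq> {#} \<and>
     \<not> (\<exists>S \<in> zero_sum_sequences. \<exists>T \<in> zero_sum_sequences. S \<noteq> {#} \<and> T \<noteq> {#} \<and> U = S + T)}"

text \<open>
  A product of \<open>k\<close> atoms is given by a multiset of \<open>k\<close> atoms.  The empty product is included,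
  so the empty sequence needs no separate clause; see the two lemmas below.
\<close>

definition set_of_lengths :: "'g::ab_group_add multiset \<Rightarrow> nat set" where
  "set_of_lengths A = {k. \<exists>F. set_mset F \<subseteq> zero_sum_atoms \<and> size F = k \<and> \<Sum>\<^sub># F = A}"

lemma set_of_lengths_empty: "set_of_lengths {#} = {0}"
proof -
  have "F = {#}" if "set_mset F \<subseteq> zero_sum_atoms" "\<Sum>\<^sub># F = {#}" for F :: "'g::ab_group_add multiset multiset"
    using that by (cases F) (auto simp: zero_sum_atoms_def)
  moreover have "set_mset {#} \<subseteq> zero_sum_atoms \<and> size {#} = 0 \<and> \<Sum>\<^sub># {#} = {#}"
    by simp
  ultimately show ?thesis
    unfolding set_of_lengths_def by fastforce
qed

lemma set_of_lengths_pos: "A \<noteq> {#} \<Longrightarrow> k \<in> set_of_lengths A \<Longrightarrow> k \<ge> 1"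
  by (cases k) (auto simp: set_of_lengths_def)

definition system_of_sets_of_lengths :: "'g::ab_group_add itself \<Rightarrow> nat set set" where
  "system_of_sets_of_lengths _ = set_of_lengths ` (zero_sum_sequences :: 'g multiset set)"

text \<open>
  The numeral types \<open>2\<close> and \<open>4\<close> carry addition modulo 2 and 4; addition on pairs is componentwise.
\<close>

type_synonym C2_C4 = "2 \<times> 4"

text \<open>
  All sets of integers below consist of nonnegative integers and are therefore sets of type
  \<^typ>\<open>nat set\<close>.  Translation \<open>m + A\<close> is \<open>m +o A\<close> and dilation is \<open>m *o A\<close>.
\<close>

definition \<L>\<^sub>1 :: "nat set set" where
  "\<L>\<^sub>1 = {{y} | y. True}"

definition \<L>\<^sub>2 :: "nat set set" where
  "\<L>\<^sub>2 = {(y + 2 * nat \<lceil>real k / 3\<rceil>) +o {0..k} | y k. k \<ge> 1 \<and> k \<noteq> 3}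
      \<union> {y +o {3..6} | y. True}
      \<union> {{2 * t + 1..5 * t + 2} | t. t \<ge> 1}"

definition \<L>\<^sub>3 :: "nat set set" where
  "\<L>\<^sub>3 = {(y + 2 * k) +o (2 *o {0..k}) | y k. k \<ge> 1}"

definition \<L>\<^sub>4 :: "nat set set" where
  "\<L>\<^sub>4 = {(y + k + 1) +o ({0} \<union> {2..k + 2}) | y k. k \<ge> 1 \<and> odd k}"

definition \<L>\<^sub>5 :: "nat set set" where
  "\<L>\<^sub>5 = {(y + k + 2) +o ({0..k} \<union> {k + 2}) | y k. k \<ge> 1}"

end

theory Submission
  imports Defs
begin

text \<open>
  Write \<open>\<pm>g, \<pm>h\<close> for the elements of order 4. Let \<open>k\<close> be a length of \<open>A\<close> which is not maximal and such
  that \<open>k + 1\<close> is not a length, and take a factorization of length \<open>k\<close> with as many atoms of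
  size 2 as possible. If no two atoms of size at least 3 in it contain opposite elements, orient
  \<open>\<pm>g\<close> and \<open>\<pm>h\<close> so that only positive elements occur in these atoms and give positive elements of
  order 4 the weight 1, negative ones 3, elements of order 2 the weight 2, and zero the weight 4: every
  atom weighs at least 4, and the factorization shows that \<open>A\<close> weighs less than \<open>4 (k + 1)\<close>, so
  \<open>k\<close> would be maximal. Hence there are two atoms with opposite elements \<open>x\<close>, \<open>-x\<close>, and pulling
  out \<open>x (-x)\<close> must leave a sequence that is neither an atom nor a product of two atoms. Up to
  automorphism only five pairs of atoms have this property. For each of them, the atoms which can
  accompany the pair are so restricted that \<open>k + 2\<close> is a length and the set of lengths
  has one of three shapes: all lengths have the same parity, or the set is one of \<open>\<L>\<^sub>4\<close>, or
  \<open>k + 2\<close> is the maximum. Without such gaps the set of lengths is an interval. Intervals are realized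
  by multiplying five small examples repeatedly by \<open>U (-U)\<close> with \<open>U\<close> an atom of size 5.
\<close>

section \<open>Sequences over the group and their atoms\<close>

text \<open>The group enters only through its 39 atoms. Statements about one atom or a pair of atoms
  are evaluated, and the unbounded part rests on weights: bounds or a residue for the weight of each
  atom dividing a sequence give, summed over a factorization, bounds or a parity for its length.
  With zero counted twice, atoms have sizes from 2 to 5, so two lengths differ by a factor of at
  most 5/2; the intervals in \<open>\<L>\<^sub>2\<close> are governed by this factor.

  The obstacle is that the widest range is not filled: for an atom \<open>U\<close> of size 5 the
  product \<open>U (-U)\<close> has the lengths 2, 4, 5 but not 3. This missing 3 makes
  \<open>[2, 5]\<close> an exceptional interval, is responsible for \<open>\<L>\<^sub>4\<close>, and
  has to be bridged when intervals are built. The family \<open>\<L>\<^sub>5\<close> has another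
  origin: if a sequence consists of opposite pairs and its atoms have only the sizes 2 and 4, the
  length just below the maximum would need exactly one atom of size 4, and this atom would itself
  consist of opposite pairs.\<close>

text \<open>The prime marks the negative of an element of order 4; moreover \<open>H = G + A\<close>, \<open>B = A + F\<close> and \<open>F = 2 G = 2 H\<close>.\<close>

datatype c24 = Z | G | G' | H | H' | A | B | F

lemma all_c24: "(\<forall>x::c24. Q x) \<longleftrightarrow> Q Z \<and> Q G \<and> Q G' \<and> Q H \<and> Q H' \<and> Q A \<and> Q B \<and> Q F"
  by (metis c24.exhaust)

lemma UNIV_c24: "UNIV = {Z, G, G', H, H', A, B, F}"
  using c24.exhaust by blast

lemma mset_eq_c24: "S = T \<longleftrightarrow> (\<forall>x::c24. count S x = count T x)"
  by (auto intro: multiset_eqI)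

text \<open>Atoms of size 5 are listed in the form \<open>x, x, x, c, y\<close> with \<open>c\<close> of order 2; \<open>five_opposite_check\<close> relies on it.\<close>

definition atom_list :: "c24 list list" where
  "atom_list = [[Z],
    [G, G'],
    [H, H'],
    [A, A],
    [B, B],
    [F, F],
    [G, G, F],
    [G, H, B],
    [G, H', A],
    [G', G', F],
    [G', H, A],
    [G', H', B],
    [H, H, F],
    [H', H', F],
    [A, B, F],
    [G, G, G, G],
    [G, G, H, H],
    [G, G, H', H'],
    [G, G, A, B],
    [G, H, A, F],
    [G, H', B, F],
    [G', G', G', G'],
    [G', G', H, H],
    [G', G', H', H'],
    [G', G', A, B],
    [G', H, B, F],
    [G', H', A, F],
    [H, H, H, H],
    [H, H, A, B],
    [H', H', H', H'],
    [H', H', A, B],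
    [G, G, G, A, H],
    [G, G, G, B, H'],
    [G', G', G', A, H'],
    [G', G', G', B, H],
    [H, H, H, A, G],
    [H, H, H, B, G'],
    [H', H', H', A, G'],
    [H', H', H', B, G]]"

definition atoms :: "c24 multiset set" where
  "atoms = mset ` set atom_list"

definition wt :: "(c24 \<Rightarrow> int) \<Rightarrow> c24 multiset \<Rightarrow> int" where
  "wt w S = (\<Sum>x\<in>#S. w x)"

lemma wt_simps [simp]:
  "wt w {#} = 0" "wt w (add_mset x S) = w x + wt w S" "wt w (S + T) = wt w S + wt w T"
  "wt w (replicate_mset n x) = int n * w x"
  by (simp_all add: wt_def)

lemma wt_Union: "wt w (\<Sum>\<^sub># z) = (\<Sum>u\<in>#z. wt w u)"
  by (induction z) auto

lemma wt_count: "wt w S = int (count S Z) * w Z + int (count S G) * w G + int (count S G') * w G'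
   + int (count S H) * w H + int (count S H') * w H' + int (count S A) * w A
   + int (count S B) * w B + int (count S F) * w F"
proof (induction S)
  case (add x S)
  then show ?case by (cases x) (auto simp: algebra_simps)
qed auto

text \<open>The coordinates in C_2 and C_4 are lifted to integers, so that being zero-sum becomes a
  pair of divisibilities of ordinary weights.\<close>

fun chi1 :: "c24 \<Rightarrow> int" where
  "chi1 Z = 0" | "chi1 G = 0" | "chi1 G' = 0" | "chi1 H = 1" | "chi1 H' = 1" | "chi1 A = 1" | "chi1 B = 1" | "chi1 F = 0"

fun chi2 :: "c24 \<Rightarrow> int" where
  "chi2 Z = 0" | "chi2 G = 1" | "chi2 G' = 3" | "chi2 H = 1" | "chi2 H' = 3" | "chi2 A = 0" | "chi2 B = 2" | "chi2 F = 2"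

definition emb :: "c24 \<Rightarrow> C2_C4" where
  "emb x = (of_int (chi1 x), of_int (chi2 x))"

definition zs :: "c24 multiset \<Rightarrow> bool" where
  "zs S \<longleftrightarrow> 2 dvd wt chi1 S \<and> 4 dvd wt chi2 S"

lemma of_int_2_eq_0: "(of_int n :: 2) = 0 \<longleftrightarrow> 2 dvd n"
  by (simp add: of_int_eq_0_iff_char_dvd)

lemma of_int_4_eq_0: "(of_int n :: 4) = 0 \<longleftrightarrow> 4 dvd n"
  by (simp add: of_int_eq_0_iff_char_dvd)

lemma sum_emb: "\<Sum>\<^sub># (image_mset emb S) = (of_int (wt chi1 S), of_int (wt chi2 S))"
  by (induction S) (auto simp: emb_def zero_prod_def)

lemma zs_iff: "zs S \<longleftrightarrow> image_mset emb S \<in> zero_sum_sequences"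
  by (simp add: zs_def zero_sum_sequences_def sum_emb zero_prod_def of_int_2_eq_0 of_int_4_eq_0)

lemma inj_emb: "inj emb"
proof (rule injI)
  fix x y assume "emb x = emb y"
  hence "(of_int (chi1 x - chi1 y) :: 2) = 0" "(of_int (chi2 x - chi2 y) :: 4) = 0"
    by (auto simp: emb_def)
  hence "2 dvd chi1 x - chi1 y" "4 dvd chi2 x - chi2 y"
    by (simp_all only: of_int_2_eq_0 of_int_4_eq_0)
  thus "x = y" by (cases x; cases y) auto
qed

lemma bij_emb: "bij emb"
proof -
  have "card (range emb) = card (UNIV :: C2_C4 set)"
    by (subst card_image[OF inj_emb]) (simp add: UNIV_c24)
  hence "range emb = UNIV" by (intro card_subset_eq) auto
  thus ?thesis using inj_emb by (simp add: bij_def)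
qed

text \<open>Avoiding the listed squares and fourth powers bounds multiplicities by 1 at order 2 and
  by 3 at order 4; avoiding \<open>[G, G']\<close> and \<open>[H, H']\<close> leaves at most one
  element of each opposite pair. Of the finitely many functions that remain, each nonzero one
  contains another listed atom or violates a congruence. This is the completeness of
  \<open>atom_list\<close>.\<close>

lemma zs_free_arith:
  fixes c :: "c24 \<Rightarrow> nat"
  assumes no: "\<forall>u\<in>set atom_list. \<not> (\<forall>x. count (mset u) x \<le> c x)"
    and even: "(c H + c H' + c A + c B) mod 2 = 0"
      "(c G + 3 * c G' + c H + 3 * c H' + 2 * c B + 2 * c F) mod 4 = 0"
  shows "\<forall>x. c x = 0"
proof -
  note 1 = no[unfolded atom_list_def all_c24, simplified]
  have two: "n = 0 \<or> n = 1" if "n < 2" for n :: nat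
    using that by auto
  have four: "n = 0 \<or> n = 1 \<or> n = 2 \<or> n = 3" if "n < 4" for n :: nat
    using that by auto
  have "c F < 2" "c A < 2" "c B < 2"
    using no[THEN bspec, of "[F, F]"] no[THEN bspec, of "[A, A]"] no[THEN bspec, of "[B, B]"]
    by (simp_all add: atom_list_def all_c24)
  note ab = this[THEN two]
  have "c G < 4" "c G' < 4" "c H < 4" "c H' < 4"
    using no[THEN bspec, of "[G, G, G, G]"] no[THEN bspec, of "[G', G', G', G']"]
      no[THEN bspec, of "[H, H, H, H]"] no[THEN bspec, of "[H', H', H', H']"]
    by (simp_all add: atom_list_def all_c24)
  note val = ab this[THEN four]
  have "c G = 0 \<or> c G' = 0" "c H = 0 \<or> c H' = 0"
    using no[THEN bspec, of "[G, G']"] no[THEN bspec, of "[H, H']"]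
    by (auto simp add: atom_list_def all_c24)
  then have "(c G = 0 \<and> c H = 0 \<or> c G = 0 \<and> c H' = 0) \<or> (c G' = 0 \<and> c H = 0 \<or> c G' = 0 \<and> c H' = 0)" by blast
  then have "c G = 0 \<and> c G' = 0 \<and> c H = 0 \<and> c H' = 0 \<and> c A = 0 \<and> c B = 0 \<and> c F = 0"
  proof (elim disjE conjE)
    assume *: "c G = 0" "c H = 0"
    show ?thesis using val(1-3,5,7) by (elim disjE) (use 1 even in \<open>simp_all add: *\<close>)
  next
    assume *: "c G = 0" "c H' = 0"
    show ?thesis using val(1-3,5,6) by (elim disjE) (use 1 even in \<open>simp_all add: *\<close>)
  next
    assume *: "c G' = 0" "c H = 0"
    show ?thesis using val(1-3,4,7) by (elim disjE) (use 1 even in \<open>simp_all add: *\<close>)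
  next
    assume *: "c G' = 0" "c H' = 0"
    show ?thesis using val(1-3,4,6) by (elim disjE) (use 1 even in \<open>simp_all add: *\<close>)
  qed
  moreover have "c Z = 0" using 1 by simp
  ultimately show ?thesis by (simp add: all_c24)
qed

lemma zs_contains_atom:
  assumes "zs S" "S \<noteq> {#}"
  shows "\<exists>u\<in>atoms. u \<subseteq># S"
proof (rule ccontr)
  assume "\<not> ?thesis"
  hence no: "\<forall>u\<in>set atom_list. \<not> (\<forall>x. count (mset u) x \<le> count S x)"
    by (auto simp: atoms_def subseteq_mset_def)
  have "(count S H + count S H' + count S A + count S B) mod 2 = 0"
    "(count S G + 3 * count S G' + count S H + 3 * count S H' + 2 * count S B + 2 * count S F) mod 4 = 0"
    using assms(1) unfolding zs_def wt_count by (simp_all) presburger+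
  from zs_free_arith[OF no this] have "S = {#}" by (simp add: mset_eq_c24)
  thus False using assms(2) by simp
qed

section \<open>Containment and equality of multisets, decided on lists\<close>

fun take_out :: "'a list \<Rightarrow> 'a list \<Rightarrow> 'a list option" where
  "take_out [] r = Some r"
| "take_out (x # xs) r = (if x \<in> set r then take_out xs (remove1 x r) else None)"

lemma take_out_Some: "take_out w r = Some r' \<Longrightarrow> mset r = mset w + mset r'"
proof (induction w r rule: take_out.induct)
  case (2 x xs r)
  hence "x \<in> set r" "mset r - {#x#} = mset xs + mset r'" by (auto split: if_splits)
  thus ?case by (metis insert_DiffM mset.simps(2) set_mset_mset union_mset_add_mset_left)
qed auto

lemma take_out_None: "take_out w r = None \<Longrightarrow> \<not> mset w \<subseteq># mset r"
proof (induction w r rule: take_out.induct)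
  case (2 x xs r)
  then show ?case by (auto split: if_splits simp: insert_subset_eq_iff)
qed auto

definition perm_eq :: "'a list \<Rightarrow> 'a list \<Rightarrow> bool" where
  "perm_eq u v = (if length u = length v then take_out u v \<noteq> None else False)"

lemma perm_eqD:
  assumes "perm_eq u v"
  shows "mset u = mset v"
proof -
  obtain r where r: "take_out u v = Some r" and l: "length u = length v"
    using assms by (auto simp: perm_eq_def split: if_splits)
  have "mset v = mset u + mset r" using take_out_Some[OF r] .
  moreover from arg_cong[OF this, of size] have "r = []" using l by simp
  ultimately show ?thesis by simp
qed

lemma atom_list_antichain_check:
  "list_all (\<lambda>u. list_all (\<lambda>v. if length u < length v then take_out u v = None else True) atom_list) atom_list"
  by code_simp

text \<open>Only pairs of different lengths have to be checked, because a sub-multiset of equal size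
  is the whole multiset.\<close>

lemma atoms_antichain:
  assumes "u \<in> atoms" "v \<in> atoms" "u \<subseteq># v"
  shows "u = v"
proof -
  obtain u' v' where *: "u = mset u'" "v = mset v'" "u' \<in> set atom_list" "v' \<in> set atom_list"
    using assms by (auto simp: atoms_def)
  have "\<not> length u' < length v'"
  proof
    assume "length u' < length v'"
    hence "take_out u' v' = None"
      using atom_list_antichain_check * by (auto simp: list_all_iff)
    from take_out_None[OF this] show False using assms * by simp
  qed
  hence "size v \<le> size u" by (simp add: *)
  with assms(3) show ?thesis
    by (metis mset_subset_size nless_le not_le subset_mset.nless_le)
qed

lemma ball_atoms: "(\<forall>u\<in>atoms. Q u) \<longleftrightarrow> (\<forall>u\<in>set atom_list. Q (mset u))"
  by (simp add: atoms_def)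

lemma zs_atom: "u \<in> atoms \<Longrightarrow> zs u"
proof -
  have "\<forall>u\<in>atoms. zs u"
    unfolding ball_atoms by (simp add: atom_list_def zs_def)
  thus "u \<in> atoms \<Longrightarrow> zs u" by blast
qed

lemma atom_nonempty: "u \<in> atoms \<Longrightarrow> u \<noteq> {#}"
  by (auto simp: atoms_def atom_list_def)

lemma zs_add_iff: "zs S \<Longrightarrow> zs (S + T) \<longleftrightarrow> zs T"
  unfolding zs_def by (auto simp: dvd_add_right_iff)

section \<open>Passage between the datatype and the group of pairs\<close>

definition dec :: "C2_C4 multiset \<Rightarrow> c24 multiset" where
  "dec S = image_mset (inv emb) S"

lemma dec_emb [simp]: "dec (image_mset emb S) = S"
  by (simp add: dec_def multiset.map_comp o_def inv_f_f[OF inj_emb])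

lemma emb_dec [simp]: "image_mset emb (dec S) = S"
  by (simp add: dec_def multiset.map_comp o_def surj_f_inv_f[OF bij_is_surj[OF bij_emb]])

lemma dec_add: "dec (S + T) = dec S + dec T"
  by (simp add: dec_def)

lemma dec_eq_empty [simp]: "dec S = {#} \<longleftrightarrow> S = {#}"
  by (simp add: dec_def)

text \<open>A nonempty zero-sum sequence contains a listed atom whose complement is again zero-sum,
  so an irreducible one is listed. Conversely, a proper factor of a listed atom would contain a
  smaller listed atom, against \<open>atoms_antichain\<close>.\<close>

lemma zero_sum_atoms_eq: "zero_sum_atoms = image_mset emb ` atoms"
proof (intro equalityI subsetI)
  fix U assume "U \<in> image_mset emb ` atoms"
  then obtain u where u: "u \<in> atoms" "U = image_mset emb u" by blast
  have False if "S \<in> zero_sum_sequences" "T \<in> zero_sum_sequences" "S \<noteq> {#}" "T \<noteq> {#}" "U = S + T" for S T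
  proof -
    have ust: "u = dec S + dec T" using that(5) u by (metis dec_add dec_emb)
    have "zs (dec S)" "dec S \<noteq> {#}" using that by (simp_all add: zs_iff)
    then obtain w where w: "w \<in> atoms" "w \<subseteq># dec S" using zs_contains_atom by blast
    hence "w \<subseteq># u" unfolding ust by (simp add: subset_mset.add_increasing2)
    hence "w = u" using atoms_antichain w u by blast
    hence "size (dec S) \<ge> size u" using w size_mset_mono by blast
    moreover have "size (dec T) > 0" using that(4) by (simp add: dec_def nonempty_has_size)
    ultimately show False unfolding ust size_union by linarith
  qed
  moreover have "U \<in> zero_sum_sequences" using zs_atom u zs_iff by blast
  moreover have "U \<noteq> {#}" using u atom_nonempty by auto
  ultimately show "U \<in> zero_sum_atoms" unfolding zero_sum_atoms_def by blast
next
  fix U :: "C2_C4 multiset" assume U: "U \<in> zero_sum_atoms"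
  hence "zs (dec U)" "dec U \<noteq> {#}" by (simp_all add: zero_sum_atoms_def zs_iff)
  then obtain w where w: "w \<in> atoms" "w \<subseteq># dec U" using zs_contains_atom by blast
  then obtain t where t: "dec U = w + t" by (auto simp: mset_subset_eq_exists_conv)
  have "zs t" using zs_add_iff[OF zs_atom[OF w(1)]] t \<open>zs (dec U)\<close> by metis
  have Ut: "U = image_mset emb w + image_mset emb t" using t by (metis emb_dec image_mset_union)
  have "t = {#}"
  proof (rule ccontr)
    assume "t \<noteq> {#}"
    moreover have "image_mset emb w \<in> zero_sum_sequences" "image_mset emb t \<in> zero_sum_sequences"
      using zs_atom[OF w(1)] \<open>zs t\<close> by (simp_all add: zs_iff)
    ultimately show False
      using U Ut atom_nonempty[OF w(1)] unfolding zero_sum_atoms_def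
      by (metis (mono_tags, lifting) image_mset_is_empty_iff mem_Collect_eq)
  qed
  thus "U \<in> image_mset emb ` atoms" using Ut w by simp
qed

section \<open>Lengths of factorizations over the datatype\<close>

definition lens :: "c24 multiset \<Rightarrow> nat set" where
  "lens S = {k. \<exists>z. set_mset z \<subseteq> atoms \<and> size z = k \<and> \<Sum>\<^sub># z = S}"

lemma lensI: "set_mset z \<subseteq> atoms \<Longrightarrow> \<Sum>\<^sub># z = S \<Longrightarrow> size z = k \<Longrightarrow> k \<in> lens S"
  by (auto simp: lens_def)

lemma image_mset_Union_mset: "image_mset f (\<Sum>\<^sub># z) = \<Sum>\<^sub># (image_mset (image_mset f) z)"
  by (induction z) auto

lemma set_of_lengths_emb: "set_of_lengths (image_mset emb S) = lens S"
proof (intro equalityI subsetI)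
  fix k assume "k \<in> lens S"
  then obtain z where "set_mset z \<subseteq> atoms" "size z = k" "\<Sum>\<^sub># z = S" by (auto simp: lens_def)
  thus "k \<in> set_of_lengths (image_mset emb S)"
    unfolding set_of_lengths_def zero_sum_atoms_eq
    by (intro CollectI exI[of _ "image_mset (image_mset emb) z"]) (auto simp: image_mset_Union_mset)
next
  fix k assume "k \<in> set_of_lengths (image_mset emb S)"
  then obtain z where z: "set_mset z \<subseteq> image_mset emb ` atoms" "size z = k" "\<Sum>\<^sub># z = image_mset emb S"
    unfolding set_of_lengths_def zero_sum_atoms_eq by blast
  have "dec (\<Sum>\<^sub># z) = \<Sum>\<^sub># (image_mset dec z)"
    unfolding dec_def by (simp add: image_mset_Union_mset dec_def[abs_def])
  hence "\<Sum>\<^sub># (image_mset dec z) = S" using z(3) by simp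
  moreover have "set_mset (image_mset dec z) \<subseteq> atoms" using z(1) by auto
  ultimately show "k \<in> lens S" using z(2) by (intro lensI[of "image_mset dec z"]) auto
qed

lemma system_eq: "system_of_sets_of_lengths TYPE(C2_C4) = lens ` {S. zs S}"
proof -
  have eq: "(zero_sum_sequences :: C2_C4 multiset set) = image_mset emb ` {S. zs S}"
  proof (intro equalityI subsetI)
    fix U :: "C2_C4 multiset" assume "U \<in> zero_sum_sequences"
    hence "zs (dec U)" by (simp add: zs_iff)
    thus "U \<in> image_mset emb ` {S. zs S}" by (intro image_eqI[of _ _ "dec U"]) auto
  qed (auto simp: zs_iff)
  show ?thesis
    unfolding system_of_sets_of_lengths_def eq image_image set_of_lengths_emb ..
qed

lemma lens_0: "0 \<in> lens {#}"
  by (rule lensI[of "{#}"]) auto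

lemma lens_atom: "u \<in> atoms \<Longrightarrow> 1 \<in> lens u"
  by (rule lensI[of "{#u#}"]) auto

lemma lens_add: "k \<in> lens S \<Longrightarrow> l \<in> lens T \<Longrightarrow> k + l \<in> lens (S + T)"
  unfolding lens_def
proof (elim CollectE exE conjE)
  fix y z assume "set_mset y \<subseteq> atoms" "size y = k" "\<Sum>\<^sub># y = S" "set_mset z \<subseteq> atoms" "size z = l" "\<Sum>\<^sub># z = T"
  thus "k + l \<in> {k. \<exists>z. set_mset z \<subseteq> atoms \<and> size z = k \<and> \<Sum>\<^sub># z = S + T}"
    by (intro CollectI exI[of _ "y + z"]) auto
qed

lemma lens_list:
  assumes "set ls \<subseteq> set atom_list" "mset (concat ls) = S"
  shows "length ls \<in> lens S"
proof (rule lensI[of "mset (map mset ls)"])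
  have "mset (concat ls) = \<Sum>\<^sub># (mset (map mset ls))" by (simp only: mset_concat sum_mset_sum_list)
  thus "\<Sum>\<^sub># (mset (map mset ls)) = S" using assms(2) by simp
qed (use assms(1) in \<open>auto simp: atoms_def\<close>)

lemma lens_nonempty: "zs S \<Longrightarrow> lens S \<noteq> {}"
proof (induction "size S" arbitrary: S rule: less_induct)
  case less
  show ?case
  proof (cases "S = {#}")
    case False
    then obtain w t where w: "w \<in> atoms" "S = w + t"
      using zs_contains_atom[OF less.prems] by (auto simp: mset_subset_eq_exists_conv)
    have "size t < size S" using w atom_nonempty[OF w(1)] by (simp add: nonempty_has_size)
    moreover have "zs t" using zs_add_iff[OF zs_atom[OF w(1)]] w less.prems by metis
    ultimately obtain k where "k \<in> lens t" using less.hyps by blast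
    thus ?thesis using lens_add[OF lens_atom[OF w(1)]] w by blast
  qed (use lens_0 in auto)
qed

lemma lens_zs: "k \<in> lens S \<Longrightarrow> zs S"
proof -
  have "set_mset z \<subseteq> atoms \<Longrightarrow> zs (\<Sum>\<^sub># z)" for z
    by (induction z) (auto simp: zs_atom zs_add_iff, simp add: zs_def)
  thus "k \<in> lens S \<Longrightarrow> zs S" by (auto simp: lens_def)
qed

lemma mset_le_Union: "u \<in># z \<Longrightarrow> u \<subseteq># \<Sum>\<^sub># z"
  by (induction z) (auto simp: subset_mset.add_increasing subset_mset.add_increasing2)

section \<open>Weights as bounds for lengths\<close>

lemma wt_lower:
  assumes "\<And>u. u \<in> atoms \<Longrightarrow> u \<subseteq># S \<Longrightarrow> c \<le> wt w u" "k \<in> lens S"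
  shows "int k * c \<le> wt w S"
proof -
  obtain z where z: "set_mset z \<subseteq> atoms" "size z = k" "\<Sum>\<^sub># z = S" using assms(2) by (auto simp: lens_def)
  have "\<And>u. u \<in># z \<Longrightarrow> c \<le> wt w u" using z assms(1) mset_le_Union by blast
  hence "int (size z) * c \<le> (\<Sum>u\<in>#z. wt w u)"
    by (induction z) (auto simp: algebra_simps intro: add_mono)
  thus ?thesis using z wt_Union by metis
qed

lemma wt_upper:
  assumes "\<And>u. u \<in> atoms \<Longrightarrow> u \<subseteq># S \<Longrightarrow> wt w u \<le> c" "k \<in> lens S"
  shows "wt w S \<le> int k * c"
proof -
  obtain z where z: "set_mset z \<subseteq> atoms" "size z = k" "\<Sum>\<^sub># z = S" using assms(2) by (auto simp: lens_def)
  have "\<And>u. u \<in># z \<Longrightarrow> wt w u \<le> c" using z assms(1) mset_le_Union by blast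
  hence "(\<Sum>u\<in>#z. wt w u) \<le> int (size z) * c"
    by (induction z) (auto simp: algebra_simps intro: add_mono)
  thus ?thesis using z wt_Union by metis
qed

text \<open>Each atom contributes 4 modulo 8, so the weight of the sequence determines the parity of
  the length.\<close>

lemma wt_cong:
  assumes "\<And>u. u \<in> atoms \<Longrightarrow> u \<subseteq># S \<Longrightarrow> wt w u mod 8 = 4" "k \<in> lens S"
  shows "(wt w S - 4 * int k) mod 8 = 0"
proof -
  obtain z where z: "set_mset z \<subseteq> atoms" "size z = k" "\<Sum>\<^sub># z = S" using assms(2) by (auto simp: lens_def)
  have "\<And>u. u \<in># z \<Longrightarrow> wt w u mod 8 = 4" using z assms(1) mset_le_Union by blast
  hence "((\<Sum>u\<in>#z. wt w u) - 4 * int (size z)) mod 8 = 0"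
  proof (induction z)
    case (add u z)
    hence "wt w u mod 8 = 4" "((\<Sum>u\<in>#z. wt w u) - 4 * int (size z)) mod 8 = 0" by auto
    moreover have "(a + b - (4 + 4 * n)) mod 8 = 0" if "a mod 8 = 4" "(b - 4 * n) mod 8 = 0" for a b n :: int
      using that by presburger
    ultimately show ?case by simp
  qed simp
  thus ?thesis using z wt_Union by metis
qed

section \<open>Automorphisms and the maximal length\<close>

fun neg :: "c24 \<Rightarrow> c24" where
  "neg Z = Z" | "neg G = G'" | "neg G' = G" | "neg H = H'" | "neg H' = H" | "neg A = A" | "neg B = B" | "neg F = F"

text \<open>The automorphism group is dihedral of order 8, generated by \<open>swap1\<close> and \<open>swap2\<close>.\<close>

fun swap1 :: "c24 \<Rightarrow> c24" where
  "swap1 H = H'" | "swap1 H' = H" | "swap1 A = B" | "swap1 B = A" | "swap1 Z = Z" | "swap1 G = G" | "swap1 G' = G'" | "swap1 F = F"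

fun swap2 :: "c24 \<Rightarrow> c24" where
  "swap2 G = H" | "swap2 H = G" | "swap2 G' = H'" | "swap2 H' = G'" | "swap2 Z = Z" | "swap2 A = A" | "swap2 B = B" | "swap2 F = F"

text \<open>Both generators are reflections, so the alternating words of length at most 4 represent
  the whole group; the last one is negation.\<close>

definition auts :: "(c24 \<Rightarrow> c24) list" where
  "auts = [id, swap1, swap2, swap1 \<circ> swap2, swap2 \<circ> swap1, swap1 \<circ> swap2 \<circ> swap1,
    swap2 \<circ> swap1 \<circ> swap2, swap1 \<circ> swap2 \<circ> swap1 \<circ> swap2]"

lemma swap_atoms_check:
  "list_all (\<lambda>u. list_ex (perm_eq (map swap1 u)) atom_list \<and> list_ex (perm_eq (map swap2 u)) atom_list) atom_list"
  by code_simp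

lemma swap_atoms:
  assumes "u \<in> atoms"
  shows "image_mset swap1 u \<in> atoms" "image_mset swap2 u \<in> atoms"
proof -
  obtain u' where u': "u' \<in> set atom_list" "u = mset u'" using assms by (auto simp: atoms_def)
  have "list_ex (perm_eq (map swap1 u')) atom_list \<and> list_ex (perm_eq (map swap2 u')) atom_list"
    using bspec[OF swap_atoms_check[unfolded list_all_iff] u'(1)] .
  then obtain v w where v: "v \<in> set atom_list" "perm_eq (map swap1 u') v"
    and w: "w \<in> set atom_list" "perm_eq (map swap2 u') w"
    unfolding list_ex_iff by (elim conjE bexE)
  have "image_mset swap1 u = mset v" "image_mset swap2 u = mset w"
    using perm_eqD[OF v(2)] perm_eqD[OF w(2)] u'(2) by simp_all
  thus "image_mset swap1 u \<in> atoms" "image_mset swap2 u \<in> atoms"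
    using v(1) w(1) unfolding atoms_def by (auto intro: image_eqI)
qed

lemma swap1_swap1 [simp]: "swap1 (swap1 x) = x"
  by (cases x) simp_all

lemma swap2_swap2 [simp]: "swap2 (swap2 x) = x"
  by (cases x) simp_all

text \<open>Lengths depend only on which multisets are atoms, so preservation of atoms is required
  in place of additivity.\<close>

definition aut :: "(c24 \<Rightarrow> c24) \<Rightarrow> bool" where
  "aut \<phi> \<longleftrightarrow> bij \<phi> \<and> (\<forall>u. image_mset \<phi> u \<in> atoms \<longleftrightarrow> u \<in> atoms)"

lemma aut_involution:
  assumes "\<And>x. \<phi> (\<phi> x) = x" "\<And>u. u \<in> atoms \<Longrightarrow> image_mset \<phi> u \<in> atoms"
  shows "aut \<phi>"
proof -
  have "image_mset \<phi> (image_mset \<phi> u) = u" for u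
    by (simp add: multiset.map_comp o_def assms(1))
  moreover have "bij \<phi>" using assms(1) by (rule involuntory_imp_bij)
  ultimately show ?thesis unfolding aut_def using assms(2) by metis
qed

lemma aut_swap: "aut swap1" "aut swap2"
  by (rule aut_involution; simp add: swap_atoms)+

lemma aut_comp: "aut \<phi> \<Longrightarrow> aut \<psi> \<Longrightarrow> aut (\<phi> \<circ> \<psi>)"
  by (simp add: aut_def bij_comp flip: multiset.map_comp)

lemma aut_auts: "\<phi> \<in> set auts \<Longrightarrow> aut \<phi>"
proof -
  have "aut id" by (simp add: aut_def)
  hence "\<forall>\<phi>\<in>set auts. aut \<phi>"
    unfolding auts_def list.set by (intro ballI) (elim insertE emptyE; simp add: aut_swap aut_comp)
  thus "\<phi> \<in> set auts \<Longrightarrow> aut \<phi>" by blast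
qed

lemma aut_inv: assumes "aut \<phi>" shows "aut (inv \<phi>)"
proof -
  have "\<phi> (inv \<phi> x) = x" for x
    using assms by (simp add: aut_def bij_is_surj surj_f_inv_f)
  hence "image_mset \<phi> (image_mset (inv \<phi>) u) = u" for u
    by (simp add: multiset.map_comp o_def)
  hence "image_mset (inv \<phi>) u \<in> atoms \<longleftrightarrow> u \<in> atoms" for u
    using assms unfolding aut_def by metis
  thus ?thesis using assms by (simp add: aut_def bij_imp_bij_inv)
qed

lemma lens_image:
  assumes "aut \<phi>" "k \<in> lens S"
  shows "k \<in> lens (image_mset \<phi> S)"
proof -
  obtain z where z: "set_mset z \<subseteq> atoms" "size z = k" "\<Sum>\<^sub># z = S" using assms by (auto simp: lens_def)
  show ?thesis
  proof (rule lensI[of "image_mset (image_mset \<phi>) z"])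
    show "set_mset (image_mset (image_mset \<phi>) z) \<subseteq> atoms" using z assms(1) by (auto simp: aut_def)
    show "\<Sum>\<^sub># (image_mset (image_mset \<phi>) z) = image_mset \<phi> S"
      by (simp add: image_mset_Union_mset flip: z(3))
  qed (use z in simp)
qed

lemma lens_aut: assumes "aut \<phi>" shows "lens (image_mset \<phi> S) = lens S"
proof -
  have "inv \<phi> (\<phi> x) = x" for x
    using assms by (simp add: aut_def bij_is_inj)
  hence "image_mset (inv \<phi>) (image_mset \<phi> S) = S"
    by (simp add: multiset.map_comp o_def)
  thus ?thesis using lens_image[OF assms] lens_image[OF aut_inv[OF assms]] by (metis subsetI subset_antisym)
qed

text \<open>The flags tell which of \<open>\<pm>g\<close> and \<open>\<pm>h\<close> are positive.\<close>

fun wpos :: "bool \<Rightarrow> bool \<Rightarrow> c24 \<Rightarrow> int" where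
  "wpos p q Z = 4"
| "wpos p q G = (if p then 1 else 3)" | "wpos p q G' = (if p then 3 else 1)"
| "wpos p q H = (if q then 1 else 3)" | "wpos p q H' = (if q then 3 else 1)"
| "wpos p q A = 2" | "wpos p q B = 2" | "wpos p q F = 2"

lemma wpos_ge: "u \<in> atoms \<Longrightarrow> 4 \<le> wt (wpos p q) u"
proof -
  have "\<forall>u\<in>atoms. 4 \<le> wt (wpos p q) u"
    unfolding ball_atoms by (cases p; cases q) (simp_all add: atom_list_def)
  thus "u \<in> atoms \<Longrightarrow> 4 \<le> wt (wpos p q) u" by blast
qed

lemma wpos_short: "u \<in> atoms \<Longrightarrow> size u < 3 \<Longrightarrow> wt (wpos p q) u = 4"
proof -
  have "\<forall>u\<in>atoms. size u < 3 \<longrightarrow> wt (wpos p q) u = 4"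
    unfolding ball_atoms by (cases p; cases q) (simp_all add: atom_list_def)
  thus "u \<in> atoms \<Longrightarrow> size u < 3 \<Longrightarrow> wt (wpos p q) u = 4" by blast
qed

text \<open>The element counted on the right is the difference of the two positive elements of order
  4. Some character to C_4 takes the value 1 on both of these, 0 on their difference and 2 on the
  other elements of order 2; hence an atom of positive elements weighs twice this count modulo
  4.\<close>

lemma wpos_long:
  "u \<in> atoms \<Longrightarrow> size u \<ge> 3 \<Longrightarrow> (if p then G' else G) \<notin># u \<Longrightarrow> (if q then H' else H) \<notin># u \<Longrightarrow>
    wt (wpos p q) u = 4 + 2 * int (count u (if p = q then A else B))"
proof -
  have "\<forall>u\<in>atoms. size u \<ge> 3 \<longrightarrow> (if p then G' else G) \<notin># u \<longrightarrow> (if q then H' else H) \<notin># u \<longrightarrow>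
    wt (wpos p q) u = 4 + 2 * int (count u (if p = q then A else B))"
    unfolding ball_atoms by (cases p; cases q) (simp_all add: atom_list_def)
  thus "u \<in> atoms \<Longrightarrow> size u \<ge> 3 \<Longrightarrow> (if p then G' else G) \<notin># u \<Longrightarrow> (if q then H' else H) \<notin># u \<Longrightarrow>
    wt (wpos p q) u = 4 + 2 * int (count u (if p = q then A else B))" by blast
qed

lemma long_atom:
  "u \<in> atoms \<Longrightarrow> size u \<ge> 3 \<Longrightarrow> Z \<notin># u \<and> (G \<notin># u \<or> G' \<notin># u) \<and> (H \<notin># u \<or> H' \<notin># u) \<and>
    count u A \<le> 1 \<and> count u B \<le> 1"
proof -
  have "\<forall>u\<in>atoms. size u \<ge> 3 \<longrightarrow> Z \<notin># u \<and> (G \<notin># u \<or> G' \<notin># u) \<and> (H \<notin># u \<or> H' \<notin># u) \<and>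
    count u A \<le> 1 \<and> count u B \<le> 1"
    unfolding ball_atoms by (simp add: atom_list_def)
  thus "u \<in> atoms \<Longrightarrow> size u \<ge> 3 \<Longrightarrow> Z \<notin># u \<and> (G \<notin># u \<or> G' \<notin># u) \<and> (H \<notin># u \<or> H' \<notin># u) \<and>
    count u A \<le> 1 \<and> count u B \<le> 1" by blast
qed

lemma pair_subset: "u \<in># z \<Longrightarrow> v \<in># z \<Longrightarrow> u \<noteq> v \<Longrightarrow> {#u, v#} \<subseteq># z"
  by (simp add: insert_subset_eq_iff in_diff_count)

text \<open>Only the difference \<open>c\<close> of the two positive elements pushes a long atom
  above weight 4. Since \<open>c\<close> is its own opposite, it lies in at most one long atom, and
  only once there. So \<open>S\<close> weighs at most 4 times \<open>size z\<close> plus 2, too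
  little for one more atom.\<close>

lemma no_opposites_imp_max:
  assumes z: "set_mset z \<subseteq> atoms" "\<Sum>\<^sub># z = S"
    and no: "\<And>u v x. {#u, v#} \<subseteq># z \<Longrightarrow> size u \<ge> 3 \<Longrightarrow> size v \<ge> 3 \<Longrightarrow> x \<in># u \<Longrightarrow> neg x \<notin># v"
    and j: "j \<in> lens S"
  shows "j \<le> size z"
proof -
  define y where "y = filter_mset (\<lambda>u. size u \<ge> 3) z"
  \<comment> \<open>If \<open>G'\<close> occurs in some long atom, then \<open>G\<close> occurs in
    none, so the orientation can be read off from \<open>G'\<close> alone; likewise for
    \<open>H'\<close>.\<close>
  define p where "p \<longleftrightarrow> (\<forall>u\<in>#y. G' \<notin># u)"
  define q where "q \<longleftrightarrow> (\<forall>u\<in>#y. H' \<notin># u)"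
  define c where "c = (if p = q then A else B)"
  have y: "u \<in> atoms" "size u \<ge> 3" "u \<in># z" if "u \<in># y" for u
    using that z by (auto simp: y_def)
  have no': "neg x \<notin># v" if "u \<in># y" "v \<in># y" "x \<in># u" "x = G \<or> x = G' \<or> x = H \<or> x = H'" for u v x
  proof (cases "u = v")
    case True
    thus ?thesis using long_atom[OF y(1,2)[OF that(1)]] that by auto
  next
    case False
    show ?thesis
      using no[OF pair_subset[OF y(3) y(3) False] y(2) y(2), OF that(1,2,1,2,3)] .
  qed
  have p: "(if p then G' else G) \<notin># u" if "u \<in># y" for u
  proof (cases p)
    case False
    then obtain v where "v \<in># y" "G' \<in># v" unfolding p_def by blast
    from no'[OF this(1) that this(2)] show ?thesis using False by simp
  qed (use that in \<open>simp add: p_def\<close>)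
  have q: "(if q then H' else H) \<notin># u" if "u \<in># y" for u
  proof (cases q)
    case False
    then obtain v where "v \<in># y" "H' \<in># v" unfolding q_def by blast
    from no'[OF this(1) that this(2)] show ?thesis using False by simp
  qed (use that in \<open>simp add: q_def\<close>)
  have wy: "wt (wpos p q) u = 4 + 2 * int (count u c)" if "u \<in># y" for u
    unfolding c_def using wpos_long[OF y(1,2)[OF that] p[OF that] q[OF that]] .
  have "(\<Sum>u\<in>#y. count u c) \<le> 1"
  proof (cases "\<exists>u\<in>#y. c \<in># u")
    case True
    then obtain u where u: "u \<in># y" "c \<in># u" by blast
    then obtain y' where y': "y = add_mset u y'" by (metis insert_DiffM)
    have "c \<notin># v" if "v \<in># y'" for v
    proof -
      have "{#u, v#} \<subseteq># y" using y' that by simp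
      hence "{#u, v#} \<subseteq># z" unfolding y_def by (meson multiset_filter_subset subset_mset.order_trans)
      moreover have "v \<in># y" using that y' by simp
      moreover have "neg c = c" by (simp add: c_def)
      ultimately show ?thesis using no[OF _ y(2)[OF u(1)] y(2) u(2), of v] by simp
    qed
    hence "(\<Sum>v\<in>#y'. count v c) = 0" by (simp add: count_eq_zero_iff)
    moreover have "count u c \<le> 1" using long_atom[OF y(1,2)[OF u(1)]] by (simp add: c_def)
    moreover have "(\<Sum>u\<in>#y. count u c) = count u c + (\<Sum>v\<in>#y'. count v c)" by (simp add: y')
    ultimately show ?thesis by linarith
  next
    case False
    hence "(\<Sum>u\<in>#y. count u c) = 0" by (simp add: count_eq_zero_iff)
    thus ?thesis by linarith
  qed
  moreover have "(\<Sum>u\<in>#y. wt (wpos p q) u) = 4 * int (size y) + 2 * int (\<Sum>u\<in>#y. count u c)"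
    using wy by (induction y) auto
  moreover have "(\<Sum>u\<in>#filter_mset (\<lambda>u. \<not> size u \<ge> 3) z. wt (wpos p q) u)
      = 4 * int (size (filter_mset (\<lambda>u. \<not> size u \<ge> 3) z))"
    using z(1) wpos_short by (induction z) auto
  moreover have yz: "z = y + filter_mset (\<lambda>u. \<not> size u \<ge> 3) z" unfolding y_def by simp
  moreover have "wt (wpos p q) S = (\<Sum>u\<in>#z. wt (wpos p q) u)" using z(2) wt_Union by metis
  moreover have "(\<Sum>u\<in>#z. wt (wpos p q) u)
      = (\<Sum>u\<in>#y. wt (wpos p q) u) + (\<Sum>u\<in>#filter_mset (\<lambda>u. \<not> size u \<ge> 3) z. wt (wpos p q) u)"
    using arg_cong[OF yz, of "\<lambda>z. \<Sum>u\<in>#z. wt (wpos p q) u"] by simp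
  moreover have "size z = size y + size (filter_mset (\<lambda>u. \<not> size u \<ge> 3) z)"
    using arg_cong[OF yz, of size] by simp
  moreover have "int j * 4 \<le> wt (wpos p q) S"
    using wt_lower[OF _ j] wpos_ge by blast
  ultimately show ?thesis by linarith
qed

section \<open>Pairs of atoms with opposite elements\<close>

definition splits :: "c24 list \<Rightarrow> bool" where
  "splits r = list_ex (\<lambda>w. case take_out w r of None \<Rightarrow> False
     | Some r' \<Rightarrow> if r' = [] then True else list_ex (perm_eq r') atom_list) (rev atom_list)"

definition reducible :: "c24 list \<Rightarrow> c24 list \<Rightarrow> bool" where
  "reducible u v = list_ex (\<lambda>x. if neg x \<in> set v
     then splits (remove1 x u @ remove1 (neg x) v) else False) u"

definition opp :: "c24 list \<Rightarrow> c24 list \<Rightarrow> bool" where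
  "opp u v = list_ex (\<lambda>x. neg x \<in> set v) u"

text \<open>The five pairs (up to automorphism and order) for which pulling out \<open>x (-x)\<close> never leaves an atom or a product of two atoms. The one further pair in \<open>pair_ok\<close> is such that its product has another factorization of length 3.\<close>

definition special_list :: "(c24 list \<times> c24 list) list" where
  "special_list = [([G,G,G,G], [G',G',G',G']), ([G',G',G',G'], [G,G,G,A,H]),
     ([G,G,G,A,H], [G',G',G',A,H']), ([G,G,H,H], [G',G',H',H']), ([G,G,A,B], [G',G',A,B])]"

definition equiv_in :: "(c24 list \<times> c24 list) list \<Rightarrow> c24 list \<Rightarrow> c24 list \<Rightarrow> bool" where
  "equiv_in ps u v = list_ex (\<lambda>\<phi>. list_ex (\<lambda>(p, q).
     if perm_eq (map \<phi> u) p then perm_eq (map \<phi> v) q else False) ps) auts"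

definition long_list :: "c24 list list" where
  "long_list = filter (\<lambda>u. length u \<ge> 3) atom_list"

definition pair_ok :: "c24 list \<Rightarrow> c24 list \<Rightarrow> bool" where
  "pair_ok u v = (if opp u v then if reducible u v then True
     else if equiv_in special_list u v then True else if equiv_in special_list v u then True
     else equiv_in [([H,H,H,B,G'], [G,G,G,B,H'])] u v else True)"

lemma pair_check: "list_all (\<lambda>u. list_all (pair_ok u) long_list) long_list"
  by code_simp

lemma equiv_inD:
  assumes "equiv_in ps u v"
  shows "\<exists>\<phi> p q. aut \<phi> \<and> (p, q) \<in> set ps \<and> image_mset \<phi> (mset u) = mset p \<and> image_mset \<phi> (mset v) = mset q"
proof -
  obtain \<phi> p q where "\<phi> \<in> set auts" "(p, q) \<in> set ps" "perm_eq (map \<phi> u) p" "perm_eq (map \<phi> v) q"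
    using assms unfolding equiv_in_def list_ex_iff by (auto split: if_splits)
  thus ?thesis using perm_eqD[of "map \<phi> u" p] perm_eqD[of "map \<phi> v" q] aut_auts by fastforce
qed

lemma splitsD:
  assumes "splits r"
  shows "\<exists>ws. set ws \<subseteq> set atom_list \<and> (length ws = 1 \<or> length ws = 2) \<and> mset r = mset (concat ws)"
proof -
  obtain w r' where w: "w \<in> set atom_list" "take_out w r = Some r'"
    and r': "r' = [] \<or> list_ex (perm_eq r') atom_list"
    using assms unfolding splits_def list_ex_iff by (auto split: option.splits if_splits)
  have r: "mset r = mset w + mset r'" using take_out_Some[OF w(2)] .
  show ?thesis
  proof (cases "r' = []")
    case True
    thus ?thesis using w r by (intro exI[of _ "[w]"]) auto
  next
    case False
    then obtain v where "v \<in> set atom_list" "perm_eq r' v" using r' by (auto simp: list_ex_iff)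
    thus ?thesis using w r perm_eqD[of r' v] by (intro exI[of _ "[w, v]"]) auto
  qed
qed

lemma reducibleD:
  assumes "reducible u v"
  shows "\<exists>x ws. x \<in> set u \<and> set ws \<subseteq> set atom_list \<and> (length ws = 1 \<or> length ws = 2) \<and>
    mset u + mset v = {#x, neg x#} + mset (concat ws)"
proof -
  obtain x where x: "x \<in> set u" "neg x \<in> set v" "splits (remove1 x u @ remove1 (neg x) v)"
    using assms unfolding reducible_def list_ex_iff by (auto split: if_splits)
  obtain ws where ws: "set ws \<subseteq> set atom_list" "length ws = 1 \<or> length ws = 2"
    "mset (remove1 x u @ remove1 (neg x) v) = mset (concat ws)" using splitsD[OF x(3)] by blast
  have "mset u = {#x#} + mset (remove1 x u)" "mset v = {#neg x#} + mset (remove1 (neg x) v)"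
    using x by simp_all
  hence "mset u + mset v = {#x, neg x#} + mset (remove1 x u @ remove1 (neg x) v)"
    by (simp del: mset_remove1)
  thus ?thesis using x ws by metis
qed

lemma pair_atom: "x \<noteq> Z \<Longrightarrow> {#x, neg x#} \<in> atoms"
  by (cases x) (simp_all add: atoms_def atom_list_def image_iff add_mset_commute)

text \<open>Replacing the two atoms by four is the source of the length \<open>k + 2\<close> above a
  gap.\<close>

lemma special_pair_lens4:
  assumes "equiv_in special_list u v"
  shows "4 \<in> lens (mset u + mset v)"
proof -
  obtain \<phi> p q where *: "aut \<phi>" "(p, q) \<in> set special_list"
    "image_mset \<phi> (mset u) = mset p" "image_mset \<phi> (mset v) = mset q"
    using equiv_inD[OF assms] by blast
  have "\<exists>ls. set ls \<subseteq> set atom_list \<and> length ls = 4 \<and> mset (concat ls) = mset p + mset q"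
    using *(2) unfolding special_list_def
    apply (simp only: list.set insert_iff empty_iff prod.inject HOL.simp_thms)
    apply (elim disjE conjE)
    subgoal by (rule exI[of _ "[[G,G'],[G,G'],[G,G'],[G,G']]"]) (simp add: atom_list_def)
    subgoal by (rule exI[of _ "[[G,G'],[G,G'],[G,G'],[G',H,A]]"]) (simp add: atom_list_def)
    subgoal by (rule exI[of _ "[[G,G'],[G,G'],[G,H',A],[G',H,A]]"]) (simp add: atom_list_def)
    subgoal by (rule exI[of _ "[[G,G'],[G,G'],[H,H'],[H,H']]"]) (simp add: atom_list_def)
    subgoal by (rule exI[of _ "[[G,G'],[G,G'],[A,A],[B,B]]"]) (simp add: atom_list_def)
    done
  then obtain ls where ls: "set ls \<subseteq> set atom_list" "length ls = 4" "mset (concat ls) = image_mset \<phi> (mset u + mset v)"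
    using * by auto
  hence "4 \<in> lens (image_mset \<phi> (mset u + mset v))" using lens_list by metis
  thus ?thesis unfolding lens_aut[OF *(1)] .
qed

definition twos :: "c24 multiset multiset \<Rightarrow> nat" where
  "twos z = size (filter_mset (\<lambda>u. size u = 2) z)"

definition optimal :: "c24 multiset multiset \<Rightarrow> c24 multiset \<Rightarrow> nat \<Rightarrow> bool" where
  "optimal z S k \<longleftrightarrow> set_mset z \<subseteq> atoms \<and> \<Sum>\<^sub># z = S \<and> size z = k \<and>
     (\<forall>y. set_mset y \<subseteq> atoms \<and> \<Sum>\<^sub># y = S \<and> size y = k \<longrightarrow> twos y \<le> twos z)"

lemma ex_optimal:
  assumes "k \<in> lens S"
  shows "\<exists>z. optimal z S k"
proof -
  obtain z where "set_mset z \<subseteq> atoms \<and> \<Sum>\<^sub># z = S \<and> size z = k" using assms by (auto simp: lens_def)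
  moreover have "\<forall>y. set_mset y \<subseteq> atoms \<and> \<Sum>\<^sub># y = S \<and> size y = k \<longrightarrow> twos y < k + 1"
    by (auto simp: twos_def le_imp_less_Suc size_filter_mset_lesseq)
  ultimately show ?thesis unfolding optimal_def
    using ex_has_greatest_nat[of "\<lambda>y. set_mset y \<subseteq> atoms \<and> \<Sum>\<^sub># y = S \<and> size y = k" z twos "k + 1"] by metis
qed

text \<open>Suppose that \<open>x (-x)\<close> can be pulled out. If two atoms remain, the length
  becomes \<open>k + 1\<close>. If one atom remains, the length stays \<open>k\<close>, but the
  number of atoms of size 2 grows, because \<open>u\<close> and \<open>v\<close> did not count
  there. The table lists each pair in one order, hence the disjunction.\<close>

lemma optimal_pair:
  assumes opt: "optimal z S k" and gap: "Suc k \<notin> lens S"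
    and uv: "{#u, v#} \<subseteq># z" "size u \<ge> 3" "size v \<ge> 3" and x: "x \<in># u" "neg x \<in># v"
    and p: "p \<in> set atom_list" "u = mset p" "q \<in> set atom_list" "v = mset q"
  shows "equiv_in special_list p q \<or> equiv_in special_list q p"
proof -
  obtain z' where z: "z = {#u, v#} + z'" using uv(1) by (auto simp: mset_subset_eq_exists_conv)
  have z': "set_mset z' \<subseteq> atoms" "S = u + v + \<Sum>\<^sub># z'" "k = size z' + 2" "u \<in> atoms" "v \<in> atoms"
    using opt by (auto simp: optimal_def z)
  have "pair_ok p q"
    using pair_check p uv by (auto simp: list_all_iff long_list_def)
  moreover have "opp p q" using x p by (auto simp: opp_def list_ex_iff)
  moreover have "\<not> reducible p q"
  proof
    assume "reducible p q"
    then obtain y ws where ws: "y \<in># u" "set ws \<subseteq> set atom_list" "length ws = 1 \<or> length ws = 2"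
      "u + v = {#y, neg y#} + mset (concat ws)" using reducibleD p by fastforce
    define y' where "y' = add_mset {#y, neg y#} (mset (map mset ws) + z')"
    have "y \<noteq> Z" using ws(1) long_atom[OF z'(4) uv(2)] by auto
    hence at: "set_mset y' \<subseteq> atoms" using ws(2) z'(1) pair_atom by (auto simp: y'_def atoms_def)
    have "mset (concat ws) = \<Sum>\<^sub># (mset (map mset ws))" by (simp only: mset_concat sum_mset_sum_list)
    hence sum: "\<Sum>\<^sub># y' = S" using ws(4) z'(2) by (simp add: y'_def)
    have sz: "size y' = length ws + size z' + 1" by (simp add: y'_def)
    from ws(3) show False
    proof
      assume "length ws = 1"
      hence "size y' = k" using sz z' by simp
      hence "twos y' \<le> twos z" using opt at sum by (auto simp: optimal_def)
      moreover have "twos z = twos z'" using uv by (simp add: twos_def z)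
      moreover have "twos y' \<ge> Suc (twos z')" by (simp add: twos_def y'_def)
      ultimately show False by simp
    next
      assume "length ws = 2"
      hence "size y' = Suc k" using sz z' by simp
      with lensI[OF at sum] gap show False by simp
    qed
  qed
  moreover have "\<not> equiv_in [([H,H,H,B,G'], [G,G,G,B,H'])] p q"
  proof
    assume "equiv_in [([H,H,H,B,G'], [G,G,G,B,H'])] p q"
    from equiv_inD[OF this] obtain \<phi> where \<phi>: "aut \<phi>"
      "image_mset \<phi> u = mset [H,H,H,B,G']" "image_mset \<phi> v = mset [G,G,G,B,H']" using p by auto
    have "length [[G',H',B],[G,H,B],[G,G,H,H]] \<in> lens (image_mset \<phi> (u + v))"
      by (rule lens_list) (simp_all add: \<phi> atom_list_def)
    hence "3 \<in> lens (u + v)" unfolding lens_aut[OF \<phi>(1)] by (simp add: eval_nat_numeral)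
    hence "3 + size z' \<in> lens (u + v + \<Sum>\<^sub># z')" using lensI[OF z'(1) refl refl] lens_add by blast
    thus False using gap z' by (simp add: eval_nat_numeral)
  qed
  ultimately show ?thesis
    by (auto simp: pair_ok_def split: if_splits)
qed

section \<open>Atoms accompanying a special pair\<close>

text \<open>Each entry replaces a product of atoms by one with exactly one more atom, so none of the left-hand sides occurs in a factorization of a length below a gap.\<close>

definition improvements :: "(c24 list list \<times> c24 list list) list" where
  "improvements = [
    ([[G,G,G,G], [G',G',G',G'], [F,F]], [[G,G'], [G,G'], [G,G,F], [G',G',F]]),
    ([[G,G,G,G], [G',G',G',G'], [A,B,F]], [[G,G'], [G,G'], [G,G,F], [G',G',A,B]]),
    ([[G,G,G,G], [G',G',G',G'], [H,H,F]], [[G,G'], [G,G'], [G,G,F], [G',G',H,H]]),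
    ([[G,G,G,G], [G',G',G',G'], [H',H',F]], [[G,G'], [G,G'], [G,G,F], [G',G',H',H']]),
    ([[G,G,G,G], [G',G',G',G'], [H,H,A,B]], [[G,G'], [G,G'], [G,G,H,H], [G',G',A,B]]),
    ([[G,G,G,G], [G',G',G',G'], [H',H',A,B]], [[G,G'], [G,G'], [G,G,H',H'], [G',G',A,B]]),
    ([[G,G,G,G], [G',G',G',G'], [H,H,H,H]], [[G,G'], [G,G'], [G,G,H,H], [G',G',H,H]]),
    ([[G,G,G,G], [G',G',G',G'], [H',H',H',H']], [[G,G'], [G,G'], [G,G,H',H'], [G',G',H',H']]),
    ([[G,G,G,G], [G',G',G',G'], [H,H'], [A,A]], [[G,G'], [G,G'], [G,G'], [G,H',A], [G',H,A]]),
    ([[G,G,G,G], [G',G',G',G'], [H,H'], [B,B]], [[G,G'], [G,G'], [G,G'], [G,H,B], [G',H',B]]),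
    ([[G,G,G,G], [G',G',G',G'], [G,G,G,G], [A,A], [B,B]], [[G,G'], [G,G'], [G,G'], [G,G'], [G,G,A,B], [G,G,A,B]]),
    ([[G,G,G,G], [G',G',G',G'], [G',G',G',G'], [A,A], [B,B]], [[G,G'], [G,G'], [G,G'], [G,G'], [G',G',A,B], [G',G',A,B]]),
    ([[G,G,G,G], [G',G',G',G'], [G,G,G,G], [H,H'], [H,H']], [[G,G'], [G,G'], [G,G'], [G,G'], [G,G,H',H'], [G,G,H,H]]),
    ([[G,G,G,G], [G',G',G',G'], [G',G',G',G'], [H,H'], [H,H']], [[G,G'], [G,G'], [G,G'], [G,G'], [G',G',H',H'], [G',G',H,H]]),
    ([[G',G',G',G'], [G,G,G,A,H], [H,H,H,H]], [[G,G'], [G,G'], [H,H,H,A,G], [G',G',H,H]]),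
    ([[G',G',G',G'], [G,G,G,A,H], [H,H,F]], [[G,G'], [G,G'], [G,H,A,F], [G',G',H,H]]),
    ([[G',G',G',G'], [G,G,G,A,H], [F,F]], [[G,G'], [G,G'], [G,H,A,F], [G',G',F]]),
    ([[G',G',G',G'], [G,G,G,A,H], [B,B]], [[G,G'], [G,G'], [G,H,B], [G',G',A,B]]),
    ([[G',G',G',G'], [G,G,G,A,H], [H,H']], [[G,G'], [G,G'], [G,H',A], [G',G',H,H]]),
    ([[G,G,G,A,H], [G',G',G',A,H'], [F,F]], [[G,G'], [G,G'], [G,H,A,F], [G',H',A,F]]),
    ([[G,G,G,A,H], [G',G',G',A,H'], [B,B]], [[G,G'], [G,H,B], [G,H',A], [G',G',A,B]]),
    ([[G,G,G,A,H], [G',G',G',A,H'], [G,G']], [[G,G,G,G], [G',G',G',G'], [A,A], [H,H']]),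
    ([[G,G,G,A,H], [G',G',G',A,H'], [H,H']], [[G,G'], [G,H',A], [G,H',A], [G',G',H,H]]),
    ([[G,G,H,H], [G',G',H',H'], [G,G,H,H]], [[G,G'], [G,G'], [G,G,H',H'], [H,H,H,H]]),
    ([[G,G,H,H], [G',G',H',H'], [G',G',H',H']], [[G,G'], [G,G'], [G',G',H,H], [H',H',H',H']]),
    ([[G,G,H,H], [G',G',H',H'], [A,B,F]], [[G,G'], [G,G'], [H',H',F], [H,H,A,B]]),
    ([[G,G,A,B], [G',G',A,B], [H,H,H,H]], [[G,G'], [G,G'], [H,H,A,B], [H,H,A,B]]),
    ([[G,G,A,B], [G',G',A,B], [H',H',H',H']], [[G,G'], [G,G'], [H',H',A,B], [H',H',A,B]]),
    ([[G,G,A,B], [G',G',A,B], [H,H,F]], [[G,G'], [G,G'], [A,B,F], [H,H,A,B]]),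
    ([[G,G,A,B], [G',G',A,B], [H',H',F]], [[G,G'], [G,G'], [A,B,F], [H',H',A,B]])]"

lemma improvements_check:
  "list_all (\<lambda>(ys, ls). length ls = Suc (length ys) \<and> perm_eq (concat ys) (concat ls) \<and>
     list_all (\<lambda>w. list_ex (perm_eq w) atom_list) ls) improvements"
  by code_simp

lemma no_improvement:
  assumes z: "set_mset z \<subseteq> atoms" and gap: "Suc (size z) \<notin> lens (\<Sum>\<^sub># z)"
    and imp: "(ys, ls) \<in> set improvements" "mset (map mset ys) \<subseteq># z"
  shows False
proof -
  obtain y where y: "z = mset (map mset ys) + y" using imp by (auto simp: mset_subset_eq_exists_conv)
  have ls: "length ls = Suc (length ys)" "perm_eq (concat ys) (concat ls)" "\<forall>w\<in>set ls. list_ex (perm_eq w) atom_list"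
    using improvements_check imp(1) by (auto simp: list_all_iff)
  have at: "mset w \<in> atoms" if "w \<in> set ls" for w
    using ls(3) that perm_eqD[of w] by (fastforce simp: list_ex_iff atoms_def)
  have "\<Sum>\<^sub># (mset (map mset ls) + y) = \<Sum>\<^sub># z"
    using perm_eqD[OF ls(2)] by (simp add: y mset_concat sum_mset_sum_list del: mset_map)
  moreover have "size (mset (map mset ls) + y) = Suc (size z)" using ls(1) by (simp add: y)
  ultimately have "Suc (size z) \<in> lens (\<Sum>\<^sub># z)"
    using z at by (intro lensI[of "mset (map mset ls) + y"]) (auto simp: y)
  thus False using gap by simp
qed

text \<open>A companion of size at least 3 with an element opposite to one of \<open>v\<close> is
  itself subject to \<open>optimal_pair\<close>.\<close>

definition compatible :: "c24 list \<Rightarrow> c24 list \<Rightarrow> bool" where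
  "compatible u v = (if length u \<ge> 3 then if opp u v
     then if equiv_in special_list u v then True else equiv_in special_list v u else True else True)"

text \<open>Only the entries of \<open>improvements\<close> with three atoms are tested here; those
  with four or five atoms enter in \<open>gap_fours\<close>.\<close>

definition third_ok :: "c24 list \<Rightarrow> c24 list \<Rightarrow> c24 list \<Rightarrow> bool" where
  "third_ok p q t = (if compatible t p then if compatible t q
     then \<not> list_ex (\<lambda>(ys, ls). ys = [p, q, t]) improvements else False else False)"

definition allowed :: "(c24 list \<times> c24 list) \<Rightarrow> c24 list list" where
  "allowed pq = filter (third_ok (fst pq) (snd pq)) atom_list"

text \<open>One row for each special pair. The last two rows have no atom of size at least 3; the
  third consists of the additional factors of \<open>bowtie\<close>.\<close>

lemma allowed_eq: "map allowed special_list =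
  [[[Z],[G,G'],[H,H'],[A,A],[B,B],[G,G,G,G],[G',G',G',G'],[G,G,G,A,H],[G,G,G,B,H'],[G',G',G',A,H'],[G',G',G',B,H]],
   [[Z],[G,G'],[A,A],[G,G,G,G],[G',G',G',G'],[G',G',G',A,H']],
   [[Z],[A,A],[G,G,G,G],[G',G',G',G']],
   [[Z],[G,G'],[H,H'],[A,A],[B,B],[F,F]],
   [[Z],[G,G'],[H,H'],[A,A],[B,B],[F,F]]]"
  by code_simp

lemma third_allowed:
  assumes opt: "optimal z S k" and gap: "Suc k \<notin> lens S"
    and pq: "(p, q) \<in> set special_list" and z: "z = {#mset p, mset q#} + y" and t: "t \<in># y"
  shows "t \<in> mset ` set (allowed (p, q))"
proof -
  have at: "set_mset z \<subseteq> atoms" and gap': "Suc (size z) \<notin> lens (\<Sum>\<^sub># z)"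
    using opt gap by (auto simp: optimal_def)
  then obtain t' where t': "t' \<in> set atom_list" "t = mset t'" using t z by (auto simp: atoms_def)
  obtain y' where y': "y = add_mset t y'" using t by (metis insert_DiffM)
  have p: "p \<in> set atom_list" "q \<in> set atom_list" "length p \<ge> 3" "length q \<ge> 3"
    using pq by (auto simp: special_list_def atom_list_def)
  have "compatible t' p"
  proof -
    have "equiv_in special_list t' p \<or> equiv_in special_list p t'" if l: "length t' \<ge> 3" and o: "opp t' p"
    proof -
      obtain x where "x \<in> set t'" "neg x \<in> set p" using o by (auto simp: opp_def list_ex_iff)
      thus ?thesis using l p by (intro optimal_pair[OF opt gap, of t "mset p" x]) (auto simp: t' z y')
    qed
    thus ?thesis by (auto simp: compatible_def)
  qed
  moreover have "compatible t' q"
  proof -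
    have "equiv_in special_list t' q \<or> equiv_in special_list q t'" if l: "length t' \<ge> 3" and o: "opp t' q"
    proof -
      obtain x where "x \<in> set t'" "neg x \<in> set q" using o by (auto simp: opp_def list_ex_iff)
      thus ?thesis using l p by (intro optimal_pair[OF opt gap, of t "mset q" x]) (auto simp: t' z y')
    qed
    thus ?thesis by (auto simp: compatible_def)
  qed
  moreover have "\<not> list_ex (\<lambda>(ys, ls). ys = [p, q, t']) improvements"
  proof
    assume "list_ex (\<lambda>(ys, ls). ys = [p, q, t']) improvements"
    then obtain ls where "([p, q, t'], ls) \<in> set improvements" by (auto simp: list_ex_iff)
    from no_improvement[OF at gap' this] show False by (simp add: z y' t')
  qed
  ultimately have "third_ok p q t'" by (simp add: third_ok_def)
  thus ?thesis using t' by (auto simp: allowed_def)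
qed

section \<open>Size weights and balanced sequences\<close>

lemma lens_repeat: "k \<in> lens S \<Longrightarrow> n * k \<in> lens (repeat_mset n S)"
  by (induction n) (auto simp: lens_0 lens_add)

text \<open>Zero counts twice, so that \<open>{#Z#}\<close> has the same weight as the atoms of size 2.\<close>

fun sw :: "c24 \<Rightarrow> int" where
  "sw Z = 2" | "sw G = 1" | "sw G' = 1" | "sw H = 1" | "sw H' = 1" | "sw A = 1" | "sw B = 1" | "sw F = 1"

lemma sw_atoms: "u \<in> atoms \<Longrightarrow> 2 \<le> wt sw u \<and> wt sw u \<le> 5 \<and> (wt sw u \<le> 4 \<or> size u = 5) \<and>
    (size u \<le> 2 \<longrightarrow> wt sw u = 2) \<and> (size u \<ge> 2 \<longrightarrow> wt sw u = int (size u))"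
proof -
  have "\<forall>u\<in>atoms. 2 \<le> wt sw u \<and> wt sw u \<le> 5 \<and> (wt sw u \<le> 4 \<or> size u = 5) \<and>
    (size u \<le> 2 \<longrightarrow> wt sw u = 2) \<and> (size u \<ge> 2 \<longrightarrow> wt sw u = int (size u))"
    unfolding ball_atoms by (simp add: atom_list_def)
  thus "u \<in> atoms \<Longrightarrow> ?thesis" by blast
qed

lemma sw_bounds:
  assumes "i \<in> lens S"
  shows "2 * int i \<le> wt sw S" "wt sw S \<le> 5 * int i"
  using wt_lower[OF _ assms, of 2 sw] wt_upper[OF _ assms, of sw 5] sw_atoms by auto

text \<open>Balanced sequences are exactly the products of atoms of size at most 2. They attain the
  largest length that \<open>sw\<close> permits, half of the weight.\<close>

definition balanced :: "c24 multiset \<Rightarrow> bool" where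
  "balanced S \<longleftrightarrow> count S G = count S G' \<and> count S H = count S H' \<and>
     even (count S A) \<and> even (count S B) \<and> even (count S F)"

lemma balanced_add: "balanced S \<Longrightarrow> balanced T \<Longrightarrow> balanced (S + T)"
  by (simp add: balanced_def)

lemma balanced_short: "u \<in> atoms \<Longrightarrow> size u \<le> 2 \<Longrightarrow> balanced u"
proof -
  have "\<forall>u\<in>atoms. size u \<le> 2 \<longrightarrow> balanced u"
    unfolding ball_atoms by (simp add: atom_list_def balanced_def)
  thus "u \<in> atoms \<Longrightarrow> size u \<le> 2 \<Longrightarrow> balanced u" by blast
qed

lemma balanced_lens:
  assumes "balanced S"
  obtains m where "m \<in> lens S" "2 * int m = wt sw S"
proof -
  define n where "n x = count S x div 2" for x
  have n: "count S A = 2 * n A" "count S B = 2 * n B" "count S F = 2 * n F"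
    using assms by (auto simp: n_def balanced_def)
  have S: "S = repeat_mset (count S Z) {#Z#} + repeat_mset (count S G) {#G, G'#} + repeat_mset (count S H) {#H, H'#}
      + repeat_mset (n A) {#A, A#} + repeat_mset (n B) {#B, B#} + repeat_mset (n F) {#F, F#}"
    unfolding mset_eq_c24 all_c24 using n assms by (simp add: balanced_def)
  have "{#Z#} \<in> atoms" "{#G, G'#} \<in> atoms" "{#H, H'#} \<in> atoms" "{#A, A#} \<in> atoms" "{#B, B#} \<in> atoms" "{#F, F#} \<in> atoms"
    by (simp_all add: atoms_def atom_list_def image_iff)
  hence "count S Z * 1 + count S G * 1 + count S H * 1 + n A * 1 + n B * 1 + n F * 1 \<in> lens S"
    by (subst S, intro lens_add lens_repeat lens_atom)
  moreover have "wt sw S = 2 * int (count S Z * 1 + count S G * 1 + count S H * 1 + n A * 1 + n B * 1 + n F * 1)"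
    unfolding wt_count[of sw S] using n assms by (simp add: balanced_def)
  ultimately show ?thesis using that by metis
qed

text \<open>If \<open>x, x, x, c, y\<close> has sum zero, then \<open>y = x + c\<close>, because 4x
  = 0 and 2c = 0. Hence \<open>x + c - y\<close> and \<open>-x + c + y\<close> vanish.\<close>

lemma five_opposite_check:
  "list_all (\<lambda>u. if length u = 5 then let x = u ! 0; c = u ! 3; y = u ! 4 in
     perm_eq (u @ map neg u) (concat [[x, neg x], [x, neg x], [x, c, neg y], [neg x, c, y]]) \<and>
     list_all (\<lambda>w. list_ex (perm_eq w) atom_list) [[x, neg x], [x, neg x], [x, c, neg y], [neg x, c, y]]
   else True) atom_list"
  by code_simp

text \<open>The element of order 2 in \<open>u\<close> is its own opposite, so \<open>u (-u)\<close>
  needs it twice; its multiplicity in \<open>S\<close> is even and positive, hence large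
  enough.\<close>

lemma balanced_five_opposite:
  assumes S: "balanced S" and u: "u \<in> atoms" "size u = 5" "u \<subseteq># S"
  shows "u + image_mset neg u \<subseteq># S" "balanced (u + image_mset neg u)" "wt sw (u + image_mset neg u) = 10"
proof -
  have AB: "x \<in># S \<Longrightarrow> Suc (Suc 0) \<le> count S x" if "x = A \<or> x = B" for x
  proof -
    have "even (count S x)" using S that by (auto simp: balanced_def)
    moreover assume "x \<in># S"
    hence "count S x \<noteq> 0" by simp
    ultimately show ?thesis by presburger
  qed
  have "\<forall>u\<in>atoms. size u = 5 \<longrightarrow> u \<subseteq># S \<longrightarrow> u + image_mset neg u \<subseteq># S \<and> balanced (u + image_mset neg u) \<and>
    wt sw (u + image_mset neg u) = 10"
    unfolding ball_atoms using S AB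
    by (auto simp: atom_list_def balanced_def subseteq_mset_def all_c24)
  thus "u + image_mset neg u \<subseteq># S" "balanced (u + image_mset neg u)" "wt sw (u + image_mset neg u) = 10"
    using u by auto
qed

text \<open>Spending four atoms on \<open>u (-u)\<close>, which has weight 10, and atoms of size at
  most 2 on the balanced rest loses exactly one atom against half of the weight.\<close>

lemma balanced_five:
  assumes S: "balanced S" and u: "u \<in> atoms" "size u = 5" "u \<subseteq># S"
  obtains m where "m \<in> lens S" "2 * int m + 2 = wt sw S"
proof -
  obtain v where v: "v \<in> set atom_list" "u = mset v" "length v = 5" using u by (auto simp: atoms_def)
  define ls where "ls = [[v ! 0, neg (v ! 0)], [v ! 0, neg (v ! 0)], [v ! 0, v ! 3, neg (v ! 4)], [neg (v ! 0), v ! 3, v ! 4]]"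
  have ls: "perm_eq (v @ map neg v) (concat ls)" "\<forall>w\<in>set ls. list_ex (perm_eq w) atom_list"
    using five_opposite_check v unfolding ls_def list_all_iff Let_def by (auto split: if_splits)
  have at: "mset w \<in> atoms" if "w \<in> set ls" for w
    using ls(2) that perm_eqD[of w] by (fastforce simp: list_ex_iff atoms_def)
  define T where "T = u + image_mset neg u"
  have "4 \<in> lens T"
  proof (rule lensI[of "mset (map mset ls)"])
    show "\<Sum>\<^sub># (mset (map mset ls)) = T"
      using perm_eqD[OF ls(1)] unfolding T_def v(2) sum_mset_sum_list mset_concat[symmetric] by simp
    show "set_mset (mset (map mset ls)) \<subseteq> atoms" using at by auto
    show "size (mset (map mset ls)) = 4" by (simp add: ls_def)
  qed
  have T: "T \<subseteq># S" "balanced T" "wt sw T = 10"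
    using balanced_five_opposite[OF S u] by (simp_all add: T_def)
  then obtain R where R: "S = T + R" by (auto simp: mset_subset_eq_exists_conv)
  have "balanced R" using S T(2) by (auto simp: R balanced_def)
  then obtain m where "m \<in> lens R" "2 * int m = wt sw R" by (rule balanced_lens)
  thus ?thesis using that[of "4 + m"] lens_add[OF \<open>4 \<in> lens T\<close>] T(3) by (auto simp: R)
qed

text \<open>The alternatives lead to \<open>\<L>\<^sub>3\<close>, to \<open>\<L>\<^sub>4\<close>, and to \<open>\<L>\<^sub>5\<close> (or \<open>\<L>\<^sub>3\<close>).\<close>

definition gap_shape :: "nat \<Rightarrow> nat set \<Rightarrow> bool" where
  "gap_shape k L \<longleftrightarrow> (\<forall>i\<in>L. \<forall>j\<in>L. even (i + j) \<and> j \<le> 2 * i)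
     \<or> (\<exists>m n. L = {m} \<union> {m + 2..m + 3 + 2 * n} \<and> 2 * n + 2 \<le> m)
     \<or> (\<forall>i\<in>L. i \<le> k + 2 \<and> k + 2 \<le> 2 * i)"

text \<open>The weight \<open>w\<close> fixes the parity of the lengths; \<open>v\<close>, between 2
  and 4 on atoms, bounds their quotient by 2.\<close>

lemma gap_shape_parity:
  assumes "\<And>u. u \<in> atoms \<Longrightarrow> u \<subseteq># S \<Longrightarrow> wt w u mod 8 = 4 \<and> 2 \<le> wt v u \<and> wt v u \<le> 4"
  shows "gap_shape k (lens S)"
proof -
  have mod: "(wt w S - 4 * int i) mod 8 = 0" if "i \<in> lens S" for i
    by (rule wt_cong[OF _ that]) (simp add: assms)
  have le: "int i * 2 \<le> wt v S" if "i \<in> lens S" for i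
    by (rule wt_lower[OF _ that]) (simp add: assms)
  have ge: "wt v S \<le> int i * 4" if "i \<in> lens S" for i
    by (rule wt_upper[OF _ that]) (simp add: assms)
  have "even (i + j) \<and> j \<le> 2 * i" if ij: "i \<in> lens S" "j \<in> lens S" for i j
  proof
    show "even (i + j)" using mod[OF ij(1)] mod[OF ij(2)] by presburger
    show "j \<le> 2 * i" using le[OF ij(2)] ge[OF ij(1)] by linarith
  qed
  thus ?thesis unfolding gap_shape_def by blast
qed

text \<open>The weight is 2k + 4, so no length exceeds \<open>k + 2\<close>. An atom of size 5
  dividing \<open>S\<close> would yield the forbidden length \<open>k + 1\<close> by
  \<open>balanced_five\<close>; so all atoms weigh at most 4, which is the lower bound.\<close>

lemma gap_shape_balanced:
  assumes opt: "optimal z S k" and gap: "Suc k \<notin> lens S" and z: "z = {#u, v#} + y"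
    and uv: "size u = 4" "size v = 4" "balanced (u + v)" and y: "\<And>t. t \<in># y \<Longrightarrow> size t \<le> 2"
  shows "gap_shape k (lens S)"
proof -
  have at: "set_mset y \<subseteq> atoms" "u \<in> atoms" "v \<in> atoms" and S: "S = u + v + \<Sum>\<^sub># y" and k: "k = size y + 2"
    using opt by (auto simp: optimal_def z)
  have "wt sw (\<Sum>\<^sub># y) = 2 * int (size y)"
    using y at(1) sw_atoms by (induction y) auto
  moreover have "wt sw u = 4" "wt sw v = 4" using sw_atoms at uv by fastforce+
  ultimately have wS: "wt sw S = 2 * int k + 4" by (simp add: S k)
  have "balanced (\<Sum>\<^sub># y)"
    using y at(1) by (induction y) (auto simp: balanced_short balanced_add, simp add: balanced_def)
  hence bal: "balanced S" using balanced_add[OF uv(3)] by (simp add: S)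
  have small: "wt sw w \<le> 4" if "w \<in> atoms" "w \<subseteq># S" for w
  proof (rule ccontr)
    assume "\<not> wt sw w \<le> 4"
    hence "size w = 5" using sw_atoms that by blast
    from balanced_five[OF bal that(1) this that(2)] obtain m where "m \<in> lens S" "2 * int m + 2 = wt sw S" .
    moreover from this(2) have "m = Suc k" using wS by linarith
    ultimately show False using gap by simp
  qed
  have "i \<le> k + 2 \<and> k + 2 \<le> 2 * i" if "i \<in> lens S" for i
    using sw_bounds(1)[OF that] wt_upper[of S sw 4, OF small that] wS by simp
  thus ?thesis unfolding gap_shape_def by blast
qed

text \<open>The sequences behind \<open>\<L>\<^sub>4\<close>.\<close>

definition bowtie :: "nat \<Rightarrow> nat \<Rightarrow> nat \<Rightarrow> nat \<Rightarrow> c24 multiset" where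
  "bowtie s t y r = mset [G,G,G,A,H] + mset [G',G',G',A,H'] + repeat_mset s (mset [G,G,G,G])
     + repeat_mset t (mset [G',G',G',G']) + repeat_mset y (mset [Z]) + repeat_mset r (mset [A,A])"

lemma atom_listI: "u \<in> set atom_list \<Longrightarrow> mset u \<in> atoms"
  by (simp add: atoms_def)

text \<open>Every factor in the definition of \<open>bowtie\<close> has weight exactly 4, and no
  atom dividing the product weighs more. So the defining factorization is shortest.\<close>

fun wb :: "c24 \<Rightarrow> int" where
  "wb Z = 4" | "wb G = 1" | "wb G' = 1" | "wb H = -1" | "wb H' = -1" | "wb A = 2" | "wb B = 0" | "wb F = 0"

lemma count_bowtie:
  "count (bowtie s t y r) H = 1" "count (bowtie s t y r) H' = 1" "count (bowtie s t y r) B = 0"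
  "count (bowtie s t y r) F = 0" "count (bowtie s t y r) A = 2 * r + 2" "count (bowtie s t y r) Z = y"
  "count (bowtie s t y r) G = 4 * s + 3" "count (bowtie s t y r) G' = 4 * t + 3"
  by (simp_all add: bowtie_def)

lemma bowtie_ge:
  assumes "i \<in> lens (bowtie s t y r)"
  shows "s + t + y + r + 2 \<le> i"
proof -
  have "\<forall>u\<in>atoms. count u H \<le> 1 \<longrightarrow> count u H' \<le> 1 \<longrightarrow> count u B = 0 \<longrightarrow> count u F = 0 \<longrightarrow> wt wb u \<le> 4"
    unfolding ball_atoms by (simp add: atom_list_def)
  moreover have "count u H \<le> 1" "count u H' \<le> 1" "count u B = 0" "count u F = 0" if "u \<subseteq># bowtie s t y r" for u
    using mset_subset_eq_count[OF that, of H] mset_subset_eq_count[OF that, of H']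
      mset_subset_eq_count[OF that, of B] mset_subset_eq_count[OF that, of F] by (simp_all add: count_bowtie)
  ultimately have "wt wb (bowtie s t y r) \<le> int i * 4"
    by (intro wt_upper[OF _ assms]) blast
  moreover have "wt wb (bowtie s t y r) = 4 * int (s + t + y + r + 2)"
    unfolding wt_count count_bowtie by simp
  ultimately have "int (4 * (s + t + y + r + 2)) \<le> int (i * 4)" by simp
  thus ?thesis unfolding of_nat_le_iff by simp
qed

text \<open>The two orientations of \<open>G\<close> bound the length with s + 3t and with 3s + t;
  the smaller one is s + t + 2 min(s, t).\<close>

lemma bowtie_le:
  assumes "i \<in> lens (bowtie s t y r)"
  shows "i \<le> s + t + y + r + 5 + 2 * min s t"
proof -
  have "int i * 4 \<le> wt (wpos p True) (bowtie s t y r)" for p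
    by (intro wt_lower[OF _ assms] wpos_ge)
  from this[of True] this[of False] show ?thesis
    unfolding wt_count count_bowtie by simp
qed

lemma fours_mem:
  assumes i: "i \<le> n"
  shows "i * 4 + (n - i) * 2 \<in> lens (repeat_mset n (mset [G,G,G,G] + mset [G',G',G',G']))"
proof -
  have at: "mset [G,G,G,G] \<in> atoms" "mset [G',G',G',G'] \<in> atoms"
    by (rule atom_listI, simp add: atom_list_def)+
  have "length [[G,G'],[G,G'],[G,G'],[G,G']] \<in> lens (mset [G,G,G,G] + mset [G',G',G',G'])"
    by (rule lens_list) (simp_all add: atom_list_def)
  hence "i * 4 + (n - i) * (1 + 1) \<in> lens (repeat_mset i (mset [G,G,G,G] + mset [G',G',G',G'])
      + repeat_mset (n - i) (mset [G,G,G,G] + mset [G',G',G',G']))"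
    by (intro lens_add lens_repeat lens_atom at) (simp add: eval_nat_numeral)
  also have "repeat_mset i (mset [G,G,G,G] + mset [G',G',G',G'])
      + repeat_mset (n - i) (mset [G,G,G,G] + mset [G',G',G',G'])
      = repeat_mset n (mset [G,G,G,G] + mset [G',G',G',G'])"
    unfolding mset_eq_c24 all_c24 using i by simp
  finally show ?thesis unfolding one_add_one .
qed

lemma bowtie_mem:
  assumes "j \<le> 2 * min s t + 1"
  shows "s + t + y + r + 4 + j \<in> lens (bowtie s t y r)"
proof -
  define n where "n = min s t"
  define i where "i = j div 2"
  have i: "i \<le> n" using assms unfolding i_def n_def[symmetric] by linarith
  have at: "mset [G,G,G,G] \<in> atoms" "mset [G',G',G',G'] \<in> atoms" "mset [Z] \<in> atoms" "mset [A,A] \<in> atoms"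
    by (rule atom_listI, simp add: atom_list_def)+
  have "length [[G,G'],[G,G'],[G,H',A],[G',H,A]] \<in> lens (mset [G,G,G,A,H] + mset [G',G',G',A,H'])"
    by (rule lens_list) (simp_all add: atom_list_def)
  moreover have "length [[G,G'],[G,G'],[G,G'],[A,A],[H,H']] \<in> lens (mset [G,G,G,A,H] + mset [G',G',G',A,H'])"
    by (rule lens_list) (simp_all add: atom_list_def)
  ultimately have 1: "4 + j mod 2 \<in> lens (mset [G,G,G,A,H] + mset [G',G',G',A,H'])"
    using mod2_eq_if[of j] by (auto simp add: eval_nat_numeral split: if_splits)
  note fours_mem[OF i]
  hence "(4 + j mod 2) + (i * 4 + (n - i) * 2) + (s - n) * 1 + (t - n) * 1 + y * 1 + r * 1
    \<in> lens (mset [G,G,G,A,H] + mset [G',G',G',A,H'] + repeat_mset n (mset [G,G,G,G] + mset [G',G',G',G'])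
      + repeat_mset (s - n) (mset [G,G,G,G]) + repeat_mset (t - n) (mset [G',G',G',G'])
      + repeat_mset y (mset [Z]) + repeat_mset r (mset [A,A]))"
    by (intro lens_add 1 lens_repeat[of 1] lens_atom at)
  also have "mset [G,G,G,A,H] + mset [G',G',G',A,H'] + repeat_mset n (mset [G,G,G,G] + mset [G',G',G',G'])
      + repeat_mset (s - n) (mset [G,G,G,G]) + repeat_mset (t - n) (mset [G',G',G',G'])
      + repeat_mset y (mset [Z]) + repeat_mset r (mset [A,A]) = bowtie s t y r"
    unfolding mset_eq_c24 all_c24 by (simp add: bowtie_def n_def)
  also have "(4 + j mod 2) + (i * 4 + (n - i) * 2) + (s - n) * 1 + (t - n) * 1 + y * 1 + r * 1
      = s + t + y + r + 4 + j"
  proof -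
    have "j = 2 * i + j mod 2" by (simp add: i_def)
    moreover have "n \<le> s" "n \<le> t" by (simp_all add: n_def)
    ultimately show ?thesis using i by simp
  qed
  finally show ?thesis .
qed

text \<open>The value just above the minimum is the only one that the bounds and the explicit
  factorizations leave undecided.\<close>

lemma bowtie_lens:
  assumes "Suc (s + t + y + r + 2) \<notin> lens (bowtie s t y r)"
  shows "lens (bowtie s t y r) = {s + t + y + r + 2} \<union> {s + t + y + r + 2 + 2..s + t + y + r + 2 + 3 + 2 * min s t}"
proof (intro equalityI subsetI)
  fix i assume i: "i \<in> lens (bowtie s t y r)"
  hence "i \<noteq> Suc (s + t + y + r + 2)" using assms by blast
  thus "i \<in> {s + t + y + r + 2} \<union> {s + t + y + r + 2 + 2..s + t + y + r + 2 + 3 + 2 * min s t}"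
    using bowtie_ge[OF i] bowtie_le[OF i] by auto
next
  fix i assume "i \<in> {s + t + y + r + 2} \<union> {s + t + y + r + 2 + 2..s + t + y + r + 2 + 3 + 2 * min s t}"
  then consider "i = s + t + y + r + 2"
    | j where "i = s + t + y + r + 4 + j" "j \<le> 2 * min s t + 1"
    by (auto simp: le_iff_add)
  thus "i \<in> lens (bowtie s t y r)"
  proof cases
    case 1
    have at: "mset [G,G,G,A,H] \<in> atoms" "mset [G',G',G',A,H'] \<in> atoms"
      "mset [G,G,G,G] \<in> atoms" "mset [G',G',G',G'] \<in> atoms" "mset [Z] \<in> atoms" "mset [A,A] \<in> atoms"
      by (rule atom_listI, simp add: atom_list_def)+
    have "1 + 1 + s * 1 + t * 1 + y * 1 + r * 1 \<in> lens (bowtie s t y r)"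
      unfolding bowtie_def by (intro lens_add lens_repeat lens_atom at)
    thus ?thesis using 1 by (simp add: ac_simps)
  qed (use bowtie_mem in simp)
qed

lemma third_in:
  assumes "optimal z S k" "Suc k \<notin> lens S" "i < length special_list" "special_list ! i = (p, q)"
    "z = {#mset p, mset q#} + y"
  shows "set_mset y \<subseteq> mset ` set (map allowed special_list ! i)"
  using third_allowed[OF assms(1,2) _ assms(5)] assms(3,4) by (force simp: in_set_conv_nth)

text \<open>All admissible companions of this pair are factors of \<open>bowtie\<close>, so
  \<open>S\<close> is known completely up to four multiplicities.\<close>

lemma gap_bowtie:
  assumes opt: "optimal z S k" and gap: "Suc k \<notin> lens S"
    and z: "{#mset [G,G,G,A,H], mset [G',G',G',A,H']#} \<subseteq># z"
  shows "gap_shape k (lens S)"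
proof -
  obtain x where x: "z = {#mset [G,G,G,A,H], mset [G',G',G',A,H']#} + x"
    using z by (auto simp: mset_subset_eq_exists_conv)
  have "set_mset x \<subseteq> mset ` set [[Z],[A,A],[G,G,G,G],[G',G',G',G']]"
    using third_in[OF opt gap, of 2, OF _ _ x] unfolding allowed_eq by (simp add: special_list_def)
  hence "\<exists>s t y r. \<Sum>\<^sub># x = repeat_mset s (mset [G,G,G,G])
     + repeat_mset t (mset [G',G',G',G']) + repeat_mset y (mset [Z]) + repeat_mset r (mset [A,A])
     \<and> size x = s + t + y + r"
  proof (induction x)
    case empty
    show ?case by (intro exI[of _ 0]) simp
  next
    case (add u x)
    then obtain s t y r where IH: "\<Sum>\<^sub># x = repeat_mset s (mset [G,G,G,G])
     + repeat_mset t (mset [G',G',G',G']) + repeat_mset y (mset [Z]) + repeat_mset r (mset [A,A])"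
     "size x = s + t + y + r" by auto
    from add.prems consider "u = mset [G,G,G,G]" | "u = mset [G',G',G',G']" | "u = mset [Z]" | "u = mset [A,A]"
      by auto
    thus ?case
    proof cases
      case 1 show ?thesis by (rule exI[of _ "Suc s"], rule exI[of _ t], rule exI[of _ y], rule exI[of _ r]) (simp add: IH 1)
    next
      case 2 show ?thesis by (rule exI[of _ s], rule exI[of _ "Suc t"], rule exI[of _ y], rule exI[of _ r]) (simp add: IH 2)
    next
      case 3 show ?thesis by (rule exI[of _ s], rule exI[of _ t], rule exI[of _ "Suc y"], rule exI[of _ r]) (simp add: IH 3)
    next
      case 4 show ?thesis by (rule exI[of _ s], rule exI[of _ t], rule exI[of _ y], rule exI[of _ "Suc r"]) (simp add: IH 4)
    qed
  qed
  then obtain s t y r where sum: "\<Sum>\<^sub># x = repeat_mset s (mset [G,G,G,G])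
     + repeat_mset t (mset [G',G',G',G']) + repeat_mset y (mset [Z]) + repeat_mset r (mset [A,A])"
     "size x = s + t + y + r" by blast
  have S: "S = bowtie s t y r" and k: "k = s + t + y + r + 2"
    using opt by (auto simp: optimal_def x bowtie_def sum ac_simps)
  have "lens S = {k} \<union> {k + 2..k + 3 + 2 * min s t}"
    unfolding S k by (rule bowtie_lens) (use gap S k in simp)
  moreover have "2 * min s t + 2 \<le> k" by (simp add: k)
  ultimately show ?thesis unfolding gap_shape_def by blast
qed

section \<open>Transport of gaps along automorphisms\<close>

lemma optimal_image:
  assumes "aut \<phi>" "optimal z S k"
  shows "optimal (image_mset (image_mset \<phi>) z) (image_mset \<phi> S) k"
proof -
  have inv: "image_mset (inv \<phi>) (image_mset \<phi> u) = u" for u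
    using assms(1) by (simp add: multiset.map_comp o_def aut_def bij_is_inj)
  have twos: "twos (image_mset (image_mset \<psi>) y) = twos y" for y and \<psi> :: "c24 \<Rightarrow> c24"
    by (simp add: twos_def filter_mset_image_mset)
  have at: "set_mset (image_mset (image_mset \<psi>) y) \<subseteq> atoms" if "aut \<psi>" "set_mset y \<subseteq> atoms" for y \<psi>
    using that by (auto simp: aut_def)
  have "twos y \<le> twos z" if "set_mset y \<subseteq> atoms" "\<Sum>\<^sub># y = image_mset \<phi> S" "size y = k" for y
  proof -
    have "\<Sum>\<^sub># (image_mset (image_mset (inv \<phi>)) y) = S"
      using that(2) inv image_mset_Union_mset[of "inv \<phi>" y] by metis
    hence "twos (image_mset (image_mset (inv \<phi>)) y) \<le> twos z"
      using assms(2) that at[OF aut_inv[OF assms(1)] that(1)] by (simp add: optimal_def)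
    thus ?thesis by (simp add: twos)
  qed
  moreover have "\<Sum>\<^sub># (image_mset (image_mset \<phi>) z) = image_mset \<phi> S"
    using assms(2) image_mset_Union_mset[of \<phi> z] by (simp add: optimal_def)
  ultimately show ?thesis
    using assms at[OF assms(1)] by (simp add: optimal_def twos)
qed

lemma gap_shape_transfer:
  assumes base: "\<And>z S k. optimal z S k \<Longrightarrow> Suc k \<notin> lens S \<Longrightarrow> {#p, q#} \<subseteq># z \<Longrightarrow> gap_shape k (lens S)"
    and "aut \<phi>" "image_mset \<phi> u = p" "image_mset \<phi> v = q"
    and "optimal z S k" "Suc k \<notin> lens S" "{#u, v#} \<subseteq># z"
  shows "gap_shape k (lens S)"
proof -
  have "{#p, q#} \<subseteq># image_mset (image_mset \<phi>) z"
    using image_mset_subseteq_mono[OF assms(7), of "image_mset \<phi>"] assms(3,4) by simp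
  from base[OF optimal_image[OF assms(2,5)] _ this] show ?thesis
    using assms(6) by (simp add: lens_aut[OF assms(2)])
qed

lemma not_in_Union: "(\<And>u. u \<in># y \<Longrightarrow> x \<notin># u) \<Longrightarrow> count (\<Sum>\<^sub># y) x = 0"
  by (induction y) (auto simp: not_in_iff)

lemma gap_five_four:
  assumes opt: "optimal z S k" and gap: "Suc k \<notin> lens S"
    and z: "{#mset [G',G',G',G'], mset [G,G,G,A,H]#} \<subseteq># z"
  shows "gap_shape k (lens S)"
proof -
  obtain x where x: "z = {#mset [G',G',G',G'], mset [G,G,G,A,H]#} + x"
    using z by (auto simp: mset_subset_eq_exists_conv)
  have sub: "set_mset x \<subseteq> mset ` set [[Z],[G,G'],[A,A],[G,G,G,G],[G',G',G',G'],[G',G',G',A,H']]"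
    using third_in[OF opt gap, of 1, OF _ _ x] unfolding allowed_eq by (simp add: special_list_def)
  show ?thesis
  proof (cases "mset [G',G',G',A,H'] \<in># x")
    case True
    hence "{#mset [G,G,G,A,H], mset [G',G',G',A,H']#} \<subseteq># z"
      unfolding x by (simp add: insert_subset_eq_iff)
    thus ?thesis by (rule gap_bowtie[OF opt gap])
  next
    case False
    hence "count (\<Sum>\<^sub># x) y = 0" if "y \<in> {H, H', B, F}" for y
      using sub that by (intro not_in_Union) fastforce
    hence cnt: "count S H = 1" "count S H' = 0" "count S B = 0" "count S F = 0"
      using opt by (auto simp: optimal_def x)
    \<comment> \<open>The only atoms dividing \<open>S\<close> that contain \<open>H\<close> are
      \<open>[G', H, A]\<close> and \<open>[G, G, G, A, H]\<close>. Their other elements weigh 5 in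
      both cases, so the value 7 at \<open>H\<close> makes both weights 12, which is 4 modulo 8. The
      value 0 in \<open>v\<close> brings the two sizes down to 2 and 4.\<close>
    define w where "w = (\<lambda>y. if y = H then 7 else wpos True True y)"
    define v where "v = (\<lambda>y. if y = H then 0 else sw y)"
    have "\<forall>u\<in>atoms. count u H \<le> 1 \<longrightarrow> count u H' = 0 \<longrightarrow> count u B = 0 \<longrightarrow> count u F = 0 \<longrightarrow>
      wt w u mod 8 = 4 \<and> 2 \<le> wt v u \<and> wt v u \<le> 4"
      unfolding ball_atoms by (simp add: atom_list_def w_def v_def)
    moreover have "count u H \<le> 1 \<and> count u H' = 0 \<and> count u B = 0 \<and> count u F = 0" if "u \<subseteq># S" for u
      using mset_subset_eq_count[OF that, of H] mset_subset_eq_count[OF that, of H']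
        mset_subset_eq_count[OF that, of B] mset_subset_eq_count[OF that, of F] by (simp add: cnt)
    ultimately show ?thesis by (intro gap_shape_parity[of S w v]) blast
  qed
qed

text \<open>Companions of size 5 reduce to \<open>gap_five_four\<close>, and companions of size at
  most 2 to \<open>gap_shape_balanced\<close>. If there is a further fourth power, the longer
  entries of \<open>improvements\<close> leave either a single \<open>[H, H']\<close> and no element
  of order 2, or neither \<open>H\<close> nor \<open>H'\<close> and at most one of \<open>A\<close>,
  \<open>B\<close>. Then all atoms dividing \<open>S\<close> have orientation weight 4 modulo
  8.\<close>

lemma gap_fours:
  assumes opt: "optimal z S k" and gap: "Suc k \<notin> lens S"
    and z: "{#mset [G,G,G,G], mset [G',G',G',G']#} \<subseteq># z"
  shows "gap_shape k (lens S)"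
proof -
  obtain x where x: "z = {#mset [G,G,G,G], mset [G',G',G',G']#} + x"
    using z by (auto simp: mset_subset_eq_exists_conv)
  have sub: "set_mset x \<subseteq> mset ` set [[Z],[G,G'],[H,H'],[A,A],[B,B],[G,G,G,G],[G',G',G',G'],
      [G,G,G,A,H],[G,G,G,B,H'],[G',G',G',A,H'],[G',G',G',B,H]]"
    using third_in[OF opt gap, of 0, OF _ _ x] unfolding allowed_eq by (simp add: special_list_def)
  have at: "set_mset z \<subseteq> atoms" and gap': "Suc (size z) \<notin> lens (\<Sum>\<^sub># z)"
    using opt gap by (auto simp: optimal_def)
  \<comment> \<open>The third map is negation, the fourth is negation followed by
    \<open>swap1\<close>.\<close>
  have auts: "aut id" "aut swap1" "aut (swap1 \<circ> swap2 \<circ> swap1 \<circ> swap2)" "aut (swap1 \<circ> (swap1 \<circ> swap2 \<circ> swap1 \<circ> swap2))"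
    using aut_auts[of id] by (simp_all add: auts_def aut_swap aut_comp)
  have from_aut: "gap_shape k (lens S)"
    if "aut \<phi>" "image_mset \<phi> u = mset [G',G',G',G']" "image_mset \<phi> v = mset [G,G,G,A,H]" "{#u, v#} \<subseteq># z" for \<phi> u v
    by (rule gap_shape_transfer[OF _ that(1-3) opt gap that(4)]) (rule gap_five_four)
  consider (five) "\<exists>u\<in>set [[G,G,G,A,H],[G,G,G,B,H'],[G',G',G',A,H'],[G',G',G',B,H]]. mset u \<in># x"
    | (short) "set_mset x \<subseteq> mset ` set [[Z],[G,G'],[H,H'],[A,A],[B,B]]"
    | (long) "set_mset x \<subseteq> mset ` set [[Z],[G,G'],[H,H'],[A,A],[B,B],[G,G,G,G],[G',G',G',G']]"
      "mset [G,G,G,G] \<in># x \<or> mset [G',G',G',G'] \<in># x"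
    using sub by (simp add: subset_iff) blast
  thus ?thesis
  proof cases
    case five
    then consider "mset [G,G,G,A,H] \<in># x" | "mset [G,G,G,B,H'] \<in># x" | "mset [G',G',G',A,H'] \<in># x" | "mset [G',G',G',B,H] \<in># x"
      by auto
    thus ?thesis
    proof cases
      case 1 thus ?thesis
        by (intro from_aut[OF auts(1), of "mset [G',G',G',G']" "mset [G,G,G,A,H]"]) (auto simp: x insert_subset_eq_iff)
    next
      case 2 thus ?thesis
        by (intro from_aut[OF auts(2), of "mset [G',G',G',G']" "mset [G,G,G,B,H']"]) (auto simp: x insert_subset_eq_iff)
    next
      case 3 thus ?thesis
        by (intro from_aut[OF auts(3), of "mset [G,G,G,G]" "mset [G',G',G',A,H']"]) (auto simp: x insert_subset_eq_iff)
    next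
      case 4 thus ?thesis
        by (intro from_aut[OF auts(4), of "mset [G,G,G,G]" "mset [G',G',G',B,H]"]) (auto simp: x insert_subset_eq_iff)
    qed
  next
    case short
    have "size t \<le> 2" if "t \<in># x" for t using short that by auto
    thus ?thesis using gap_shape_balanced[OF opt gap x] by (simp add: balanced_def)
  next
    case long
    have two: False if "([[G,G,G,G], [G',G',G',G'], u, v], ls) \<in> set improvements" "mset u \<in># x" "mset v \<in># x" "u \<noteq> v \<and> mset u \<noteq> mset v" for u v ls
      using no_improvement[OF at gap' that(1)] that pair_subset[of "mset u" x "mset v"] by (simp add: x)
    have HA: "\<not> (mset [H,H'] \<in># x \<and> mset [A,A] \<in># x)" "\<not> (mset [H,H'] \<in># x \<and> mset [B,B] \<in># x)"
      using two[of "[H,H']" "[A,A]"] two[of "[H,H']" "[B,B]"] by (auto simp: improvements_def add_eq_conv_diff)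
    have three: False if "([[G,G,G,G], [G',G',G',G'], w, u, v], ls) \<in> set improvements" "{#mset u, mset v#} \<subseteq># x" "mset w \<in># x"
      "w = [G,G,G,G] \<or> w = [G',G',G',G']" "length u = 2 \<and> length v = 2" for u v w ls
    proof -
      note hyp = that
      have "{#mset w, mset u, mset v#} \<subseteq># x"
      proof -
        obtain x' where x': "x = {#mset u, mset v#} + x'" using hyp(2) by (auto simp: mset_subset_eq_exists_conv)
        have "size (mset w) = 4" "size (mset u) = 2" "size (mset v) = 2" using hyp(4,5) by auto
        hence "mset w \<noteq> mset u" "mset w \<noteq> mset v" by (force simp del: size_mset)+
        hence "mset w \<in># x'" using that(3) by (simp add: x')
        thus ?thesis by (simp add: x' insert_subset_eq_iff)
      qed
      thus False using no_improvement[OF at gap' that(1)] by (simp add: x add_mset_commute)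
    qed
    have AB: "\<not> (mset [A,A] \<in># x \<and> mset [B,B] \<in># x)"
      using three[of "[G,G,G,G]" "[A,A]" "[B,B]"] three[of "[G',G',G',G']" "[A,A]" "[B,B]"] long(2)
        pair_subset[of "mset [A,A]" x "mset [B,B]"] by (auto simp: improvements_def add_eq_conv_diff)
    have HH: "\<not> {#mset [H,H'], mset [H,H']#} \<subseteq># x"
      using three[of "[G,G,G,G]" "[H,H']" "[H,H']"] three[of "[G',G',G',G']" "[H,H']" "[H,H']"] long(2)
      by (auto simp: improvements_def)
    have S: "S = \<Sum>\<^sub># z" using opt by (simp add: optimal_def)
    show ?thesis
    proof (cases "mset [H,H'] \<in># x")
      case True
      then obtain y where y: "x = add_mset (mset [H,H']) y" by (metis insert_DiffM)
      have sub: "set_mset y \<subseteq> mset ` set [[Z],[G,G'],[G,G,G,G],[G',G',G',G']]"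
      proof -
        have "mset [H,H'] \<notin># y" "mset [A,A] \<notin># y" "mset [B,B] \<notin># y"
          using HH HA True unfolding y by (auto simp: insert_subset_eq_iff add_mset_commute)
        thus ?thesis using long(1) unfolding y by (simp add: subset_iff) blast
      qed
      have "count (\<Sum>\<^sub># y) c = 0" if "c \<in> {H, H', A, B, F}" for c
        using sub that by (intro not_in_Union) fastforce
      hence cnt: "count S H = 1" "count S H' = 1" "count S A = 0" "count S B = 0" "count S F = 0"
        by (simp_all add: S x y)
      have "\<forall>u\<in>atoms. count u H \<le> 1 \<longrightarrow> count u H' \<le> 1 \<longrightarrow> count u A = 0 \<longrightarrow> count u B = 0 \<longrightarrow> count u F = 0 \<longrightarrow>
        wt (wpos True True) u mod 8 = 4 \<and> 2 \<le> wt sw u \<and> wt sw u \<le> 4"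
        unfolding ball_atoms by (simp add: atom_list_def)
      moreover have "count u H \<le> 1 \<and> count u H' \<le> 1 \<and> count u A = 0 \<and> count u B = 0 \<and> count u F = 0" if "u \<subseteq># S" for u
        using mset_subset_eq_count[OF that, of H] mset_subset_eq_count[OF that, of H'] mset_subset_eq_count[OF that, of A]
          mset_subset_eq_count[OF that, of B] mset_subset_eq_count[OF that, of F] by (simp add: cnt)
      ultimately show ?thesis by (intro gap_shape_parity[of S "wpos True True" sw]) blast
    next
      case False
      obtain c where c: "c = A \<or> c = B" "mset [c, c] \<notin># x" using AB by blast
      have sub: "set_mset x \<subseteq> mset ` (set [[Z],[G,G'],[A,A],[B,B],[G,G,G,G],[G',G',G',G']] - {[c,c]})"
      proof
        fix t assume t: "t \<in># x"
        hence "t \<noteq> mset [H,H']" "t \<noteq> mset [c,c]" using False c(2) by auto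
        moreover have "t \<in> mset ` set [[Z],[G,G'],[H,H'],[A,A],[B,B],[G,G,G,G],[G',G',G',G']]"
          using long(1) t by blast
        ultimately show "t \<in> mset ` (set [[Z],[G,G'],[A,A],[B,B],[G,G,G,G],[G',G',G',G']] - {[c,c]})"
          using c(1) by (elim disjE) (auto simp: insert_Diff_if)
      qed
      have "count (\<Sum>\<^sub># x) y = 0" if "y \<in> {H, H', c, F}" for y
        using sub that c(1) by (intro not_in_Union) fastforce
      hence cnt: "count S H = 0" "count S H' = 0" "count S c = 0" "count S F = 0"
        using c(1) by (auto simp: S x)
      have "\<forall>u\<in>atoms. count u H = 0 \<longrightarrow> count u H' = 0 \<longrightarrow> count u c = 0 \<longrightarrow> count u F = 0 \<longrightarrow>
        wt (wpos True True) u mod 8 = 4 \<and> 2 \<le> wt sw u \<and> wt sw u \<le> 4"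
        unfolding ball_atoms using c(1) by (elim disjE) (simp_all add: atom_list_def)
      moreover have "count u H = 0 \<and> count u H' = 0 \<and> count u c = 0 \<and> count u F = 0" if "u \<subseteq># S" for u
        using mset_subset_eq_count[OF that, of H] mset_subset_eq_count[OF that, of H']
          mset_subset_eq_count[OF that, of c] mset_subset_eq_count[OF that, of F] by (simp add: cnt)
      ultimately show ?thesis by (intro gap_shape_parity[of S "wpos True True" sw]) blast
    qed
  qed
qed

lemma gap_special:
  assumes opt: "optimal z S k" and gap: "Suc k \<notin> lens S"
    and pq: "(p, q) \<in> set special_list" "{#mset p, mset q#} \<subseteq># z"
  shows "gap_shape k (lens S)"
proof -
  obtain x where x: "z = {#mset p, mset q#} + x"
    using pq(2) by (auto simp: mset_subset_eq_exists_conv)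
  obtain i where i: "i < length special_list" "special_list ! i = (p, q)"
    using pq(1) by (auto simp: in_set_conv_nth)
  note sub = third_in[OF opt gap i x, unfolded allowed_eq]
  have "i \<in> {0, 1, 2, 3, 4}" using i by (auto simp: special_list_def)
  moreover have ?thesis if "i = 3 \<or> i = 4"
  proof -
    have "size t \<le> 2" if "t \<in># x" for t
    proof -
      have "t \<in> mset ` set [[Z],[G,G'],[H,H'],[A,A],[B,B],[F,F]]"
        using sub \<open>i = 3 \<or> i = 4\<close> \<open>t \<in># x\<close> by (elim disjE; simp add: subset_iff)
      thus ?thesis by auto
    qed
    moreover have "size (mset p) = 4" "size (mset q) = 4" "balanced (mset p + mset q)"
      using i(2) that by (auto simp: special_list_def balanced_def)
    ultimately show ?thesis using gap_shape_balanced[OF opt gap x] by blast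
  qed
  ultimately show ?thesis
    using gap_fours[OF opt gap] gap_five_four[OF opt gap] gap_bowtie[OF opt gap] i(2) pq(2)
    by (auto simp: special_list_def)
qed

theorem lens_gap:
  assumes k: "k \<in> lens S" and gap: "Suc k \<notin> lens S" and j: "j \<in> lens S" "k < j"
  shows "k + 2 \<in> lens S \<and> gap_shape k (lens S)"
proof -
  obtain z where opt: "optimal z S k" using ex_optimal[OF k] by blast
  hence z: "set_mset z \<subseteq> atoms" "\<Sum>\<^sub># z = S" "size z = k" by (auto simp: optimal_def)
  obtain u v x where uv: "{#u, v#} \<subseteq># z" "size u \<ge> 3" "size v \<ge> 3" "x \<in># u" "neg x \<in># v"
    using no_opposites_imp_max[OF z(1,2) _ j(1)] j(2) z(3) by (metis not_le)
  have "u \<in># z" "v \<in># z" using uv(1) by (auto dest: mset_subset_eqD)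
  hence "u \<in> atoms" "v \<in> atoms" using z(1) by blast+
  then obtain p q where p: "p \<in> set atom_list" "u = mset p" "q \<in> set atom_list" "v = mset q"
    by (auto simp: atoms_def)
  have *: "k + 2 \<in> lens S \<and> gap_shape k (lens S)"
    if e: "equiv_in special_list p' q'" and le: "{#mset p', mset q'#} \<subseteq># z" for p' q'
  proof
    obtain y where y: "z = {#mset p', mset q'#} + y" using le by (auto simp: mset_subset_eq_exists_conv)
    have "4 + size y \<in> lens (mset p' + mset q' + \<Sum>\<^sub># y)"
      using z(1) by (intro lens_add special_pair_lens4[OF e] lensI[of y]) (auto simp: y)
    thus "k + 2 \<in> lens S" using z by (simp add: y ac_simps eval_nat_numeral)
    obtain \<phi> p0 q0 where \<phi>: "aut \<phi>" "(p0, q0) \<in> set special_list"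
      "image_mset \<phi> (mset p') = mset p0" "image_mset \<phi> (mset q') = mset q0" using equiv_inD[OF e] by blast
    show "gap_shape k (lens S)"
      by (rule gap_shape_transfer[OF _ \<phi>(1,3,4) opt gap le]) (rule gap_special[OF _ _ \<phi>(2)])
  qed
  from optimal_pair[OF opt gap uv p] show ?thesis
    using *[of p q] *[of q p] uv(1) by (auto simp: p add_mset_commute)
qed

section \<open>Restrictions on small lengths and the missing length of \<open>bowtie\<close>\<close>

lemma lens_finite: "finite (lens S)"
proof -
  have "lens S \<subseteq> {..nat (wt sw S)}" using sw_bounds(1) by fastforce
  thus ?thesis using finite_subset by blast
qed

lemma lens_one:
  assumes "1 \<in> lens S"
  shows "lens S = {1}"
proof -
  obtain z where z: "set_mset z \<subseteq> atoms" "size z = 1" "\<Sum>\<^sub># z = S" using assms by (auto simp: lens_def)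
  then obtain u where "z = {#u#}" by (metis size_1_singleton_mset)
  hence S: "S \<in> atoms" using z by simp
  have "j = 1" if j: "j \<in> lens S" for j
  proof -
    obtain y where y: "set_mset y \<subseteq> atoms" "size y = j" "\<Sum>\<^sub># y = S" using j by (auto simp: lens_def)
    have "y \<noteq> {#}" using y(3) atom_nonempty[OF S] by auto
    then obtain v y' where y': "y = add_mset v y'" by (meson multiset_cases)
    have "v \<in> atoms" "v \<subseteq># S" using y y' by auto
    hence "v = S" using atoms_antichain S by blast
    hence "\<Sum>\<^sub># y' = {#}" using y(3) y' by simp
    moreover have "w \<noteq> {#}" if "w \<in># y'" for w using that y(1) y' atom_nonempty by auto
    ultimately have "y' = {#}" by (metis mset_le_Union multiset_nonemptyE subset_mset.le_zero_eq)
    thus ?thesis using y(2) y' by simp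
  qed
  thus ?thesis using assms by blast
qed

lemma sum_list_fun_upd:
  fixes f :: "nat \<Rightarrow> 'a \<Rightarrow> 'b::comm_monoid_add"
  assumes "distinct us" "u \<in> set us" "f (Suc (n u)) u = c + f (n u) u"
  shows "(\<Sum>v\<leftarrow>us. f ((n(u := Suc (n u))) v) v) = c + (\<Sum>v\<leftarrow>us. f (n v) v)"
  using assms(1,2)
proof (induction us)
  case (Cons v us)
  show ?case
  proof (cases "v = u")
    case True
    have "(\<Sum>v\<leftarrow>us. f ((n(u := Suc (n u))) v) v) = (\<Sum>v\<leftarrow>us. f (n v) v)"
      by (rule arg_cong[of _ _ sum_list], rule map_cong) (use Cons.prems True in auto)
    thus ?thesis using True assms(3) by (simp add: ac_simps)
  next
    case False
    thus ?thesis using Cons by (simp add: ac_simps)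
  qed
qed simp

text \<open>Multiplicities of the possible atoms turn the question whether a length occurs into a
  linear system over the natural numbers.\<close>

lemma Union_mset_list:
  assumes "set_mset z \<subseteq> mset ` set us" "distinct us"
  shows "\<exists>n. \<Sum>\<^sub># z = (\<Sum>u\<leftarrow>us. repeat_mset (n u) (mset u)) \<and> size z = (\<Sum>u\<leftarrow>us. n u)"
  using assms(1)
proof (induction z)
  case empty
  show ?case by (rule exI[of _ "\<lambda>_. 0"]) (induction us; simp)
next
  case (add t z)
  then obtain n where n: "\<Sum>\<^sub># z = (\<Sum>u\<leftarrow>us. repeat_mset (n u) (mset u))" "size z = (\<Sum>u\<leftarrow>us. n u)" by auto
  obtain u where u: "u \<in> set us" "t = mset u" using add.prems by auto
  show ?case
  proof (intro exI conjI)
    show "\<Sum>\<^sub># (add_mset t z) = (\<Sum>v\<leftarrow>us. repeat_mset ((n(u := Suc (n u))) v) (mset v))"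
      using sum_list_fun_upd[OF assms(2) u(1), of "\<lambda>i v. repeat_mset i (mset v)" n t] n u by simp
    show "size (add_mset t z) = (\<Sum>v\<leftarrow>us. (n(u := Suc (n u))) v)"
      using sum_list_fun_upd[OF assms(2) u(1), of "\<lambda>i v. i" n 1] n by simp
  qed
qed

text \<open>The unknowns are the multiplicities of the nine atoms listed in
  \<open>bowtie_gap\<close>. The assumptions count \<open>G\<close>, \<open>G'\<close>,
  \<open>H\<close>, \<open>H'\<close>, \<open>A\<close> and the number of atoms, in this
  order.\<close>

lemma bowtie_arith:
  fixes n1 n2 n3 n4 n5 n6 n7 n8 n9 n :: nat
  assumes "4 * n1 + 3 * n4 + n6 + n8 = 4 * n + 3" "4 * n2 + 3 * n5 + n6 + n7 = 4 * n + 3"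
    "n4 + n7 + n9 = 1" "n5 + n8 + n9 = 1" "2 * n3 + n4 + n5 + n7 + n8 = 2"
    "n1 + n2 + n3 + n4 + n5 + n6 + n7 + n8 + n9 = 2 * n + 3"
  shows False
proof -
  have a: "n4 = 1 \<and> n7 = 0 \<and> n9 = 0 \<or> n4 = 0 \<and> n7 = 1 \<and> n9 = 0 \<or> n4 = 0 \<and> n7 = 0 \<and> n9 = 1" using assms(3) by linarith
  have b: "n5 = 1 \<and> n8 = 0 \<and> n9 = 0 \<or> n5 = 0 \<and> n8 = 1 \<and> n9 = 0 \<or> n5 = 0 \<and> n8 = 0 \<and> n9 = 1" using assms(4) by linarith
  have mod: "x mod 4 = 3" if "x + p * 4 = 3 + q * 4" for x p q :: nat
    using arg_cong[OF that, of "\<lambda>x. x mod 4"] by (simp only: mod_mult_self1) simp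
  have m: "(3 * n4 + n6 + n8) mod 4 = 3" "(3 * n5 + n6 + n7) mod 4 = 3"
    by (rule mod[of _ n1 n], use assms in linarith) (rule mod[of _ n2 n], use assms in linarith)
  \<comment> \<open>Four times the number of atoms minus the counts of \<open>G\<close> and
    \<open>G'\<close> eliminates \<open>n\<close>, \<open>n1\<close> and \<open>n2\<close> and
    bounds \<open>n6\<close>; the residues modulo 4 keep what remains of these two counts.\<close>
  have c: "4 * n3 + n4 + n5 + 2 * n6 + 3 * n7 + 3 * n8 + 4 * n9 = 6" using assms by linarith
  hence "n6 = 0 \<or> n6 = 1 \<or> n6 = 2 \<or> n6 = 3" by linarith
  thus False using a b c m assms(5) by (elim disjE conjE) simp_all
qed

lemma bowtie_gap: "2 * n + 3 \<notin> lens (bowtie n n 0 0)"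
proof
  assume "2 * n + 3 \<in> lens (bowtie n n 0 0)"
  then obtain z where z: "set_mset z \<subseteq> atoms" "size z = 2 * n + 3" "\<Sum>\<^sub># z = bowtie n n 0 0" by (auto simp: lens_def)
  let ?us = "[[G,G,G,G],[G',G',G',G'],[A,A],[G,G,G,A,H],[G',G',G',A,H'],[G,G'],[G',H,A],[G,H',A],[H,H']]"
  have atoms: "\<forall>u\<in>atoms. count u H \<le> 1 \<and> count u H' \<le> 1 \<and> count u B = 0 \<and> count u F = 0 \<and> count u Z = 0 \<longrightarrow> u \<in> mset ` set ?us"
    unfolding ball_atoms by (simp add: atom_list_def)
  have cnt: "count u H \<le> 1 \<and> count u H' \<le> 1 \<and> count u B = 0 \<and> count u F = 0 \<and> count u Z = 0" if "u \<subseteq># bowtie n n 0 0" for u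
    using mset_subset_eq_count[OF that, of H] mset_subset_eq_count[OF that, of H'] mset_subset_eq_count[OF that, of Z]
      mset_subset_eq_count[OF that, of B] mset_subset_eq_count[OF that, of F] by (simp add: count_bowtie)
  have "set_mset z \<subseteq> mset ` set ?us"
  proof
    fix u assume u: "u \<in># z"
    hence "u \<subseteq># bowtie n n 0 0" using z(3) mset_le_Union[of u z] by simp
    from bspec[OF atoms, THEN mp, OF _ cnt[OF this]] show "u \<in> mset ` set ?us" using z(1) u by blast
  qed
  from Union_mset_list[OF this] obtain m where m:
    "\<Sum>\<^sub># z = (\<Sum>u\<leftarrow>?us. repeat_mset (m u) (mset u))" "size z = (\<Sum>u\<leftarrow>?us. m u)" by auto
  have cnt: "count (bowtie n n 0 0) x = count (\<Sum>u\<leftarrow>?us. repeat_mset (m u) (mset u)) x" for x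
    using m(1) z(3) by simp
  have "4 * m [G,G,G,G] + 3 * m [G,G,G,A,H] + m [G,G'] + m [G,H',A] = 4 * n + 3"
    using cnt[of G] by (simp add: count_bowtie)
  moreover have "4 * m [G',G',G',G'] + 3 * m [G',G',G',A,H'] + m [G,G'] + m [G',H,A] = 4 * n + 3"
    using cnt[of G'] by (simp add: count_bowtie)
  moreover have "m [G,G,G,A,H] + m [G',H,A] + m [H,H'] = 1"
    using cnt[of H] by (simp add: count_bowtie)
  moreover have "m [G',G',G',A,H'] + m [G,H',A] + m [H,H'] = 1"
    using cnt[of H'] by (simp add: count_bowtie)
  moreover have "2 * m [A,A] + m [G,G,G,A,H] + m [G',G',G',A,H'] + m [G',H,A] + m [G,H',A] = 2"
    using cnt[of A] by (simp add: count_bowtie)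
  moreover have "m [G,G,G,G] + m [G',G',G',G'] + m [A,A] + m [G,G,G,A,H] + m [G',G',G',A,H'] + m [G,G']
      + m [G',H,A] + m [G,H',A] + m [H,H'] = 2 * n + 3"
    using m(2) z(2) by simp
  ultimately show False by (rule bowtie_arith)
qed

text \<open>No atom weighs less than 2, so an average of 2 forces weight 2 everywhere, that is, size
  at most 2.\<close>

lemma minimal_weight_short:
  assumes "set_mset z \<subseteq> atoms" "wt sw (\<Sum>\<^sub># z) \<le> 2 * int (size z)"
  shows "\<forall>u\<in>#z. size u \<le> 2"
  using assms
proof (induction z)
  case (add u z)
  have u: "u \<in> atoms" and z: "set_mset z \<subseteq> atoms" using add.prems(1) by auto
  have "2 * int (size z) \<le> wt sw (\<Sum>\<^sub># z)" using sw_bounds(1) lensI[OF z refl refl] by blast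
  moreover have "wt sw u + wt sw (\<Sum>\<^sub># z) \<le> 2 * int (size z) + 2" using add.prems(2) by simp
  moreover have "2 \<le> wt sw u" "size u \<ge> 2 \<Longrightarrow> wt sw u = int (size u)" using sw_atoms[OF u] by auto
  ultimately have "wt sw (\<Sum>\<^sub># z) \<le> 2 * int (size z)" "size u \<le> 2" by linarith+
  thus ?case using add.IH[OF z] by simp
qed simp

lemma balanced_Union: "set_mset z \<subseteq> atoms \<Longrightarrow> \<forall>u\<in>#z. size u \<le> 2 \<Longrightarrow> balanced (\<Sum>\<^sub># z)"
  by (induction z) (auto simp: balanced_short balanced_add, simp add: balanced_def)

lemma five_atoms_check:
  "list_all (\<lambda>u. if length u = 5 then list_ex (\<lambda>\<phi>. if perm_eq (map \<phi> u) [G,G,G,A,H]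
     then perm_eq (map \<phi> (map neg u)) [G',G',G',A,H'] else False) auts else True) atom_list"
  by code_simp

text \<open>Lengths 2 and 5 force weight 10. The factorization of length 5 shows that
  \<open>S\<close> is balanced, the one of length 2 consists of two atoms of size 5. So
  \<open>S\<close> is \<open>u (-u)\<close>, up to automorphism the smallest \<open>bowtie\<close>.
  This excludes the interval \<open>[2, 5]\<close>.\<close>

lemma three_not_length:
  assumes "2 \<in> lens S" "5 \<in> lens S"
  shows "3 \<notin> lens S"
proof -
  have wS: "wt sw S = 10" using sw_bounds(2)[OF assms(1)] sw_bounds(1)[OF assms(2)] by linarith
  obtain y where y: "set_mset y \<subseteq> atoms" "size y = 5" "\<Sum>\<^sub># y = S" using assms(2) by (auto simp: lens_def)
  have bal: "balanced S" using balanced_Union[OF y(1) minimal_weight_short[OF y(1)]] y wS by simp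
  obtain z where z: "set_mset z \<subseteq> atoms" "size z = 2" "\<Sum>\<^sub># z = S" using assms(1) by (auto simp: lens_def)
  obtain u z' where u: "z = add_mset u z'" using z(2) by (cases z) auto
  obtain v where "z' = {#v#}" using z(2) u size_1_singleton_mset[of z'] by auto
  hence uv: "z = {#u, v#}" using u by simp
  have at: "u \<in> atoms" "v \<in> atoms" using z(1) uv by auto
  have S: "S = u + v" using z(3) uv by simp
  have "wt sw u \<le> 5" "wt sw v \<le> 5" using sw_atoms at by blast+
  moreover have "wt sw u + wt sw v = 10" using wS unfolding S by simp
  ultimately have "\<not> wt sw u \<le> 4" by linarith
  hence u5: "size u = 5" using sw_atoms[OF at(1)] by blast
  have "u \<subseteq># S" unfolding S by simp
  note T = balanced_five_opposite[OF bal at(1) u5 this]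
  have "S = u + image_mset neg u"
  proof -
    obtain R where R: "S = u + image_mset neg u + R" using T(1) unfolding mset_subset_eq_exists_conv by blast
    have "wt sw S = wt sw (u + image_mset neg u) + wt sw R" by (subst R) (rule wt_simps(3))
    hence "wt sw R = 0" using T(3) wS by linarith
    hence "R = {#}" unfolding wt_count by (simp add: mset_eq_c24 all_c24)
    thus ?thesis using R by simp
  qed
  obtain u' where u': "u' \<in> set atom_list" "u = mset u'" using at(1) by (auto simp: atoms_def)
  then obtain \<phi> where \<phi>: "\<phi> \<in> set auts" "perm_eq (map \<phi> u') [G,G,G,A,H]" "perm_eq (map \<phi> (map neg u')) [G',G',G',A,H']"
    using bspec[OF five_atoms_check[unfolded list_all_iff] u'(1)] u5 unfolding list_ex_iff
    by (auto split: if_splits)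
  have "image_mset \<phi> S = bowtie 0 0 0 0"
  proof -
    have "image_mset \<phi> u = mset [G,G,G,A,H]" using perm_eqD[OF \<phi>(2)] u'(2) by simp
    moreover have "image_mset \<phi> (image_mset neg u) = mset [G',G',G',A,H']"
      using perm_eqD[OF \<phi>(3)] u'(2) by (simp add: multiset.map_comp)
    ultimately show ?thesis
      unfolding \<open>S = u + image_mset neg u\<close> bowtie_def image_mset_union by simp
  qed
  hence "lens S = lens (bowtie 0 0 0 0)" using lens_aut[OF aut_auts[OF \<phi>(1)]] by metis
  thus ?thesis using bowtie_gap[of 0] by simp
qed

section \<open>Classification of sets of lengths\<close>

lemma translate_interval: "(a::nat) +o {b..c} = {a + b..a + c}"
  by (auto simp: elt_set_plus_def) (metis (no_types, lifting) add_le_cancel_left atLeastAtMost_iff le_iff_add add.assoc)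

text \<open>The common normal form of both descriptions of \<open>\<L>\<^sub>2\<close>: the factor
  5/2 bounds the quotient, the length 1 only occurs alone, and \<open>[2, 5]\<close> is the
  exception.\<close>

definition intervals :: "nat set set" where
  "intervals = {{m..n} | m n. 2 \<le> m \<and> m < n \<and> 2 * n \<le> 5 * m \<and> \<not> (m = 2 \<and> n = 5)}"

lemma intervalsI: "2 \<le> m \<Longrightarrow> m < n \<Longrightarrow> 2 * n \<le> 5 * m \<Longrightarrow> \<not> (m = 2 \<and> n = 5) \<Longrightarrow> {m..n} \<in> intervals"
  unfolding intervals_def by blast

lemma nat_ceiling_third: "nat \<lceil>real k / 3\<rceil> = (k + 2) div 3"
proof -
  define q where "q = (k + 2) div 3"
  have "k \<le> 3 * q" "3 * q < k + 3" unfolding q_def by linarith+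
  hence "real k \<le> real (3 * q)" "real (3 * q) < real (k + 3)" by (simp_all only: of_nat_le_iff of_nat_less_iff)
  hence "\<lceil>real k / 3\<rceil> = int q" by (intro ceiling_unique) simp_all
  thus ?thesis by (simp add: q_def)
qed

lemma nat_ceiling_two_thirds: "nat \<lceil>2 * real k / 3\<rceil> = (2 * k + 2) div 3"
  using nat_ceiling_third[of "2 * k"] by simp

text \<open>With k = n - m the quotient condition says that m is at least ceil(2k/3). This equals 2
  ceil(k/3) unless k = 3t + 1, where it is one smaller, namely 2t + 1; the third family supplies
  these intervals. The second family accounts for k = 3, where m = 2 is excluded.\<close>

lemma L2_eq_intervals: "\<L>\<^sub>2 = intervals"
proof (intro equalityI subsetI)
  fix X assume "X \<in> \<L>\<^sub>2"
  then consider y k where "X = {y + 2 * ((k + 2) div 3)..y + 2 * ((k + 2) div 3) + k}" "k \<ge> 1" "k \<noteq> 3"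
    | y where "X = {y + 3..y + 6}" | t where "X = {2 * t + 1..5 * t + 2}" "t \<ge> 1"
    unfolding \<L>\<^sub>2_def nat_ceiling_third translate_interval by auto
  thus "X \<in> intervals"
  proof cases
    case 1
    define q where "q = (k + 2) div 3"
    have "q \<ge> 1" "k \<le> 3 * q" using 1(2) unfolding q_def by presburger+
    hence "2 \<le> y + 2 * q \<and> y + 2 * q < y + 2 * q + k \<and> 2 * (y + 2 * q + k) \<le> 5 * (y + 2 * q) \<and>
        \<not> (y + 2 * q = 2 \<and> y + 2 * q + k = 5)"
      using 1(2,3) by presburger
    thus ?thesis unfolding intervals_def 1(1) q_def[symmetric] by blast
  next
    case 2
    thus ?thesis by (auto intro: intervalsI)
  next
    case 3
    thus ?thesis by (auto intro: intervalsI)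
  qed
next
  fix X assume "X \<in> intervals"
  then obtain m n where X: "X = {m..n}" "2 \<le> m" "m < n" "2 * n \<le> 5 * m" "\<not> (m = 2 \<and> n = 5)"
    unfolding intervals_def by blast
  define k where "k = n - m"
  have k: "k \<ge> 1" "2 * k \<le> 3 * m" and X': "X = {m..m + k}" using X by (auto simp: k_def)
  consider "k = 3" | "k \<noteq> 3" "2 * ((k + 2) div 3) \<le> m" | "k \<noteq> 3" "m < 2 * ((k + 2) div 3)" by linarith
  thus "X \<in> \<L>\<^sub>2"
  proof cases
    case 1
    hence "3 \<le> m" using X by (auto simp: k_def)
    hence "X = (m - 3) +o {3..6}" using X' 1 unfolding translate_interval by auto
    thus ?thesis unfolding \<L>\<^sub>2_def by blast
  next
    case 2
    hence "X = (m - 2 * ((k + 2) div 3) + 2 * ((k + 2) div 3)) +o {0..k}" using X' unfolding translate_interval by auto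
    thus ?thesis unfolding \<L>\<^sub>2_def nat_ceiling_third using k 2 by blast
  next
    case 3
    define t where "t = (k + 2) div 3 - 1"
    have "k = 3 * t + 1" "m = 2 * t + 1" "t \<ge> 1" using 3 k X(2) unfolding t_def by presburger+
    thus ?thesis unfolding \<L>\<^sub>2_def X' by force
  qed
qed

text \<open>At k = 1 and k = 3 the bound ceil(2k/3) would admit the minimum 1 and the interval
  \<open>[2, 5]\<close>, hence the separate families.\<close>

lemma L2_alt_eq_intervals:
  "{(y + nat \<lceil>2 * real k / 3\<rceil>) +o {0..k} | y k. k \<ge> 1 \<and> k \<notin> {1, 3}}
      \<union> ({(y + 3) +o {0..3} | y. True} \<union> {(y + 2) +o {0..1} | y. True}) = intervals" (is "?L = _")
proof (intro equalityI subsetI)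
  fix X assume "X \<in> ?L"
  then consider y k where "X = {y + (2 * k + 2) div 3..y + (2 * k + 2) div 3 + k}" "k \<ge> 1" "k \<noteq> 1" "k \<noteq> 3"
    | y where "X = {y + 3..y + 3 + 3}" | y where "X = {y + 2..y + 2 + 1}"
    unfolding nat_ceiling_two_thirds translate_interval by auto
  thus "X \<in> intervals"
  proof cases
    case 1
    define q where "q = (2 * k + 2) div 3"
    have "q \<ge> 2" "2 * k \<le> 3 * q" using 1(2,3) unfolding q_def by presburger+
    hence "2 \<le> y + q \<and> y + q < y + q + k \<and> 2 * (y + q + k) \<le> 5 * (y + q) \<and>
        \<not> (y + q = 2 \<and> y + q + k = 5)"
      using 1(2,4) by presburger
    thus ?thesis unfolding intervals_def 1(1) q_def[symmetric] by blast
  next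
    case 2
    thus ?thesis by (auto intro: intervalsI)
  next
    case 3
    thus ?thesis by (auto intro: intervalsI)
  qed
next
  fix X assume "X \<in> intervals"
  then obtain m n where X: "X = {m..n}" "2 \<le> m" "m < n" "2 * n \<le> 5 * m" "\<not> (m = 2 \<and> n = 5)"
    unfolding intervals_def by blast
  define k where "k = n - m"
  have k: "k \<ge> 1" "2 * k \<le> 3 * m" and X': "X = {m..m + k}" using X by (auto simp: k_def)
  consider "k = 3" | "k = 1" | "k \<noteq> 3" "k \<noteq> 1" by linarith
  thus "X \<in> ?L"
  proof cases
    case 1
    hence "3 \<le> m" using X by (auto simp: k_def)
    hence "X = (m - 3 + 3) +o {0..3}" using X' 1 unfolding translate_interval by auto
    thus ?thesis by blast
  next
    case 2
    hence "X = (m - 2 + 2) +o {0..1}" using X X' unfolding translate_interval by auto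
    thus ?thesis by blast
  next
    case 3
    have "(2 * k + 2) div 3 \<le> m" using k by linarith
    hence "X = (m - (2 * k + 2) div 3 + (2 * k + 2) div 3) +o {0..k}" using X' unfolding translate_interval by auto
    thus ?thesis unfolding nat_ceiling_two_thirds using k 3 by blast
  qed
qed

section \<open>Normal forms of the other families and the combinatorial classification\<close>

lemma L3_iff: "X \<in> \<L>\<^sub>3 \<longleftrightarrow> (\<exists>m k. X = {m + 2 * i | i. i \<le> k} \<and> 1 \<le> k \<and> 2 * k \<le> m)"
proof -
  have *: "a +o (2 *o {0..k}) = {a + 2 * i | i. i \<le> k}" for a k :: nat
    by (auto simp: elt_set_plus_def elt_set_times_def)
  show ?thesis
  proof
    assume "X \<in> \<L>\<^sub>3"
    then obtain y k where "X = {y + 2 * k + 2 * i | i. i \<le> k}" "1 \<le> k" unfolding \<L>\<^sub>3_def * by blast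
    thus "\<exists>m k. X = {m + 2 * i | i. i \<le> k} \<and> 1 \<le> k \<and> 2 * k \<le> m"
      by (intro exI[of _ "y + 2 * k"] exI[of _ k]) simp
  next
    assume "\<exists>m k. X = {m + 2 * i | i. i \<le> k} \<and> 1 \<le> k \<and> 2 * k \<le> m"
    then obtain m k where X: "X = {m + 2 * i | i. i \<le> k}" "1 \<le> k" "2 * k \<le> m" by blast
    have "m = (m - 2 * k) + 2 * k" using X(3) by simp
    hence "X = {(m - 2 * k) + 2 * k + 2 * i | i. i \<le> k}" using X(1) by simp
    thus "X \<in> \<L>\<^sub>3" unfolding \<L>\<^sub>3_def * using X(2) by blast
  qed
qed

lemma L4_iff: "X \<in> \<L>\<^sub>4 \<longleftrightarrow> (\<exists>m n. X = {m} \<union> {m + 2..m + 3 + 2 * n} \<and> 2 * n + 2 \<le> m)"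
proof -
  have *: "a +o ({0} \<union> {2..k + 2}) = {a} \<union> {a + 2..a + (k + 2)}" for a k :: nat
  proof -
    have "a +o ({0} \<union> {2..k + 2}) = {a + 0} \<union> (a +o {2..k + 2})" by (auto simp: elt_set_plus_def)
    thus ?thesis unfolding translate_interval by simp
  qed
  show ?thesis
  proof
    assume "X \<in> \<L>\<^sub>4"
    then obtain y k where X: "X = {y + k + 1} \<union> {y + k + 1 + 2..y + k + 1 + (k + 2)}" "odd k"
      unfolding \<L>\<^sub>4_def * by blast
    then obtain n where "k = 2 * n + 1" by (auto elim: oddE)
    thus "\<exists>m n. X = {m} \<union> {m + 2..m + 3 + 2 * n} \<and> 2 * n + 2 \<le> m"
      using X by (intro exI[of _ "y + k + 1"] exI[of _ n]) (auto simp: ac_simps)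
  next
    assume "\<exists>m n. X = {m} \<union> {m + 2..m + 3 + 2 * n} \<and> 2 * n + 2 \<le> m"
    then obtain m n where X: "X = {m} \<union> {m + 2..m + 3 + 2 * n}" "2 * n + 2 \<le> m" by blast
    have "X = {(m - (2 * n + 2)) + (2 * n + 1) + 1} \<union> {(m - (2 * n + 2)) + (2 * n + 1) + 1 + 2..(m - (2 * n + 2)) + (2 * n + 1) + 1 + ((2 * n + 1) + 2)}"
      using X by auto
    moreover have "1 \<le> 2 * n + 1" "odd (2 * n + 1)" by simp_all
    ultimately show "X \<in> \<L>\<^sub>4" unfolding \<L>\<^sub>4_def * by blast
  qed
qed

lemma L5_iff: "X \<in> \<L>\<^sub>5 \<longleftrightarrow> (\<exists>m k. X = {m..m + k} \<union> {m + k + 2} \<and> 1 \<le> k \<and> k + 2 \<le> m)"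
proof -
  have *: "a +o ({0..k} \<union> {k + 2}) = {a..a + k} \<union> {a + k + 2}" for a k :: nat
  proof -
    have "a +o ({0..k} \<union> {k + 2}) = (a +o {0..k}) \<union> {a + (k + 2)}" by (auto simp: elt_set_plus_def)
    thus ?thesis unfolding translate_interval by simp
  qed
  show ?thesis
  proof
    assume "X \<in> \<L>\<^sub>5"
    then obtain y k where "X = {y + k + 2..y + k + 2 + k} \<union> {y + k + 2 + k + 2}" "k \<ge> 1"
      unfolding \<L>\<^sub>5_def * by blast
    thus "\<exists>m k. X = {m..m + k} \<union> {m + k + 2} \<and> 1 \<le> k \<and> k + 2 \<le> m"
      by (intro exI[of _ "y + k + 2"] exI[of _ k]) auto
  next
    assume "\<exists>m k. X = {m..m + k} \<union> {m + k + 2} \<and> 1 \<le> k \<and> k + 2 \<le> m"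
    then obtain m k where X: "X = {m..m + k} \<union> {m + k + 2}" "1 \<le> k" "k + 2 \<le> m" by blast
    hence "X = {(m - (k + 2)) + k + 2..(m - (k + 2)) + k + 2 + k} \<union> {(m - (k + 2)) + k + 2 + k + 2}" by auto
    thus "X \<in> \<L>\<^sub>5" unfolding \<L>\<^sub>5_def * using X(2) by blast
  qed
qed

text \<open>If the lengths do not all satisfy the parity alternative and \<open>L\<close> is not in
  \<open>\<L>\<^sub>4\<close>, every gap has the third shape and so starts at \<open>n - 2\<close>.
  Hence there is only one gap, just below the maximum, and the bound in that shape gives the
  condition on the parameters of \<open>\<L>\<^sub>5\<close>.\<close>

lemma shape_classification:
  fixes L :: "nat set"
  assumes fin: "finite L" "L \<noteq> {}" and rho: "\<And>i j. i \<in> L \<Longrightarrow> j \<in> L \<Longrightarrow> 2 * j \<le> 5 * i"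
    and one: "1 \<in> L \<Longrightarrow> L = {1}" and no: "L \<noteq> {2..5}"
    and gap: "\<And>k j. k \<in> L \<Longrightarrow> Suc k \<notin> L \<Longrightarrow> j \<in> L \<Longrightarrow> k < j \<Longrightarrow> k + 2 \<in> L \<and> gap_shape k L"
  shows "L \<in> \<L>\<^sub>1 \<union> \<L>\<^sub>2 \<union> \<L>\<^sub>3 \<union> \<L>\<^sub>4 \<union> \<L>\<^sub>5"
proof -
  define m where "m = Min L"
  define n where "n = Max L"
  have mn: "m \<in> L" "n \<in> L" "\<And>i. i \<in> L \<Longrightarrow> m \<le> i \<and> i \<le> n"
    using fin by (auto simp: m_def n_def)
  hence "m \<le> n" by blast
  show ?thesis
  proof (cases "m = n")
    case True
    hence "L = {m}" using mn by fastforce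
    thus ?thesis unfolding \<L>\<^sub>1_def by blast
  next
    case False
    hence less: "m < n" using \<open>m \<le> n\<close> by simp
    have "m \<noteq> 0" using rho[OF mn(1,2)] less by auto
    moreover have "m \<noteq> 1" using one mn less by force
    ultimately have m2: "2 \<le> m" by simp
    show ?thesis
    proof (cases "\<exists>k\<in>L. k < n \<and> Suc k \<notin> L")
      case no_gap: False
      have "i \<in> L" if "m \<le> i" "i \<le> n" for i
        using that
      proof (induction i rule: dec_induct)
        case (step i)
        hence "i \<in> L" "i < n" by simp_all
        thus ?case using no_gap by blast
      qed (use mn in simp)
      hence "{m..n} \<subseteq> L" by auto
      moreover have "L \<subseteq> {m..n}" using mn(3) by auto
      ultimately have L: "L = {m..n}" by (rule equalityI[rotated])
      have "\<not> (m = 2 \<and> n = 5)" using L no by auto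
      hence "L \<in> \<L>\<^sub>2"
        unfolding L2_eq_intervals L by (intro intervalsI m2 less rho mn(1,2))
      thus ?thesis by blast
    next
      case True
      then obtain k where k: "k \<in> L" "k < n" "Suc k \<notin> L" by blast
      have ks: "k + 2 \<in> L" "gap_shape k L" using gap[OF k(1,3) mn(2) k(2)] by auto
      show ?thesis
      proof (cases "(\<forall>i\<in>L. \<forall>j\<in>L. even (i + j) \<and> j \<le> 2 * i) \<or> L \<in> \<L>\<^sub>4")
        case alpha: True
        show ?thesis
        proof (cases "L \<in> \<L>\<^sub>4")
          case False
          with alpha have par: "\<And>i j. i \<in> L \<Longrightarrow> j \<in> L \<Longrightarrow> even (i + j) \<and> j \<le> 2 * i" by blast
          \<comment> \<open>The successor of \<open>i\<close> has the wrong parity, so every length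
            below the maximum starts a gap.\<close>
          have step: "i + 2 \<in> L" if i: "i \<in> L" "i < n" for i
          proof -
            have "Suc i \<notin> L" using par[OF i(1), of "Suc i"] by auto
            thus ?thesis using gap[OF i(1) _ mn(2) i(2)] by blast
          qed
          define r where "r = (n - m) div 2"
          have nm: "n = m + 2 * r" using par[OF mn(1,2)] less unfolding r_def by presburger
          have mem: "m + 2 * i \<in> L" if "i \<le> r" for i
            using that
          proof (induction i)
            case (Suc i)
            thus ?case using step[of "m + 2 * i"] nm by (simp add: ac_simps)
          qed (use mn in simp)
          have "L = {m + 2 * i | i. i \<le> r}"
          proof (intro equalityI subsetI)
            fix i assume i: "i \<in> L"
            have "i = m + 2 * ((i - m) div 2)" using par[OF mn(1) i] mn(3)[OF i] by presburger
            moreover have "(i - m) div 2 \<le> r" unfolding r_def using mn(3)[OF i] by (intro div_le_mono diff_le_mono) simp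
            ultimately show "i \<in> {m + 2 * i | i. i \<le> r}" by blast
          qed (use mem in blast)
          moreover have "1 \<le> r" "2 * r \<le> m" using nm less par[OF mn(1,2)] by auto
          ultimately have "L \<in> \<L>\<^sub>3" unfolding L3_iff by blast
          thus ?thesis by blast
        qed simp
      next
        case False
        have top: "i + 2 = n \<and> n \<le> 2 * m" if i: "i \<in> L" "i < n" "Suc i \<notin> L" for i
        proof -
          have g: "i + 2 \<in> L" "gap_shape i L"
            by (rule gap[OF i(1,3) mn(2) i(2), THEN conjunct1], rule gap[OF i(1,3) mn(2) i(2), THEN conjunct2])
          from g(2) have c: "\<forall>j\<in>L. j \<le> i + 2 \<and> i + 2 \<le> 2 * j"
            unfolding gap_shape_def L4_iff[symmetric]
          proof (elim disjE)
            assume "\<forall>i\<in>L. \<forall>j\<in>L. even (i + j) \<and> j \<le> 2 * i"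
            with False show ?thesis by blast
          next
            assume "L \<in> \<L>\<^sub>4"
            with False show ?thesis by blast
          qed
          have "n \<le> i + 2" "i + 2 \<le> 2 * m" using bspec[OF c mn(2)] bspec[OF c mn(1)] by blast+
          moreover have "i + 2 \<le> n" using mn(3)[OF g(1)] by blast
          ultimately show ?thesis by linarith
        qed
        have kn: "k + 2 = n" "n \<le> 2 * m" using top[OF k] by auto
        have mk: "m \<le> k" using mn k by blast
        have "i \<in> L" if "m \<le> i" "i \<le> k" for i
          using that
        proof (induction i rule: dec_induct)
          case (step i)
          hence "i \<in> L" "i < k" by simp_all
          thus ?case using top[of i] kn(1) by (cases "Suc i \<in> L") auto
        qed (use mn in simp)
        moreover have "i \<le> k \<or> i = k + 2" if "i \<in> L" for i
          using mn(3)[OF that] kn k(3) that by (metis Suc_eq_plus1 add_2_eq_Suc' le_SucE)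
        ultimately have L: "L = {m..k} \<union> {k + 2}" using mn(3) ks(1) by fastforce
        show ?thesis
        proof (cases "m = k")
          case True
          hence "L = {m + 2 * i | i. i \<le> 1}" using L by (auto simp: le_Suc_eq)
          hence "L \<in> \<L>\<^sub>3" unfolding L3_iff using m2 by (intro exI[of _ m] exI[of _ 1]) simp
          thus ?thesis by blast
        next
          case False
          hence "L = {m..m + (k - m)} \<union> {m + (k - m) + 2} \<and> 1 \<le> k - m \<and> k - m + 2 \<le> m"
            using L mk kn by auto
          hence "L \<in> \<L>\<^sub>5" unfolding L5_iff by blast
          thus ?thesis by blast
        qed
      qed
    qed
  qed
qed

section \<open>Realization\<close>

lemma lens_classified:
  assumes "zs S"
  shows "lens S \<in> \<L>\<^sub>1 \<union> \<L>\<^sub>2 \<union> \<L>\<^sub>3 \<union> \<L>\<^sub>4 \<union> \<L>\<^sub>5"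
proof (rule shape_classification)
  show "2 * j \<le> 5 * i" if "i \<in> lens S" "j \<in> lens S" for i j
    using sw_bounds(1)[OF that(2)] sw_bounds(2)[OF that(1)] by linarith
  show "lens S \<noteq> {2..5}"
  proof
    assume "lens S = {2..5}"
    hence "2 \<in> lens S" "3 \<in> lens S" "5 \<in> lens S" by simp_all
    thus False using three_not_length by blast
  qed
qed (use lens_finite lens_nonempty[OF assms] lens_one lens_gap in blast)+

lemma zero_atom: "u \<in> atoms \<Longrightarrow> Z \<in># u \<Longrightarrow> u = {#Z#}"
proof -
  have "\<forall>u\<in>atoms. Z \<in># u \<longrightarrow> u = {#Z#}"
    unfolding ball_atoms by (simp add: atom_list_def)
  thus "u \<in> atoms \<Longrightarrow> Z \<in># u \<Longrightarrow> u = {#Z#}" by blast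
qed

text \<open>Zero is an atom and lies in no other atom. Appending zeros therefore realizes all
  translates, and only the least ones have to be constructed.\<close>

lemma lens_add_zero: "lens (add_mset Z S) = Suc ` lens S"
proof (intro equalityI subsetI)
  fix k assume "k \<in> lens (add_mset Z S)"
  then obtain z where z: "set_mset z \<subseteq> atoms" "size z = k" "\<Sum>\<^sub># z = add_mset Z S" by (auto simp: lens_def)
  have "Z \<in># \<Sum>\<^sub># z" by (simp only: z(3)) simp
  then obtain u where u: "u \<in># z" "Z \<in># u" by auto
  have "u = {#Z#}" using zero_atom z(1) u by blast
  then obtain y where y: "z = add_mset {#Z#} y" using u by (metis insert_DiffM)
  have "size y \<in> lens S" using z(1,3) by (intro lensI[of y]) (auto simp: y)
  thus "k \<in> Suc ` lens S" using z(2) y by auto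
next
  fix k assume "k \<in> Suc ` lens S"
  then obtain i where i: "i \<in> lens S" "k = Suc i" by blast
  have "{#Z#} \<in> atoms" by (simp add: atoms_def atom_list_def)
  from lens_add[OF lens_atom[OF this] i(1)] show "k \<in> lens (add_mset Z S)" using i(2) by simp
qed

lemma lens_shift: "lens (replicate_mset y Z + S) = (+) y ` lens S"
  by (induction y) (auto simp: lens_add_zero image_image)

text \<open>A sequence with some length is zero-sum by \<open>lens_zs\<close>, so this property is
  recovered at the end from nonemptiness of the set.\<close>

abbreviation realizable :: "nat set \<Rightarrow> bool" where
  "realizable L \<equiv> \<exists>S. lens S = L"

lemma realizable_interval_shift:
  assumes "realizable {m..n}"
  shows "realizable {y + m..y + n}"
proof -
  obtain S where "lens S = {m..n}" using assms by blast
  hence "lens (replicate_mset y Z + S) = {y + m..y + n}" by (simp add: lens_shift)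
  thus ?thesis by blast
qed

lemma realizable_singleton: "realizable {y}"
proof -
  have "lens {#} = {0}"
  proof -
    have "i = 0" if "i \<in> lens {#}" for i using sw_bounds(1)[OF that] by simp
    thus ?thesis using lens_0 by auto
  qed
  thus ?thesis using lens_shift[of y "{#}"] by auto
qed

text \<open>The bounds on the weight force all lengths into \<open>[m, n]\<close>, because atoms have weights between 2 and 5.\<close>

definition tight :: "nat \<Rightarrow> nat \<Rightarrow> c24 multiset \<Rightarrow> bool" where
  "tight m n S \<longleftrightarrow> {m..n} \<subseteq> lens S \<and> 5 * int m - 4 \<le> wt sw S \<and> wt sw S \<le> 2 * int n + 1"

lemma tight_lens:
  assumes "tight m n S"
  shows "lens S = {m..n}"
proof -
  have "m \<le> i \<and> i \<le> n" if "i \<in> lens S" for i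
    using sw_bounds[OF that] assms unfolding tight_def by linarith
  thus ?thesis using assms unfolding tight_def by auto
qed

lemma tight_list:
  assumes "\<forall>ls\<in>set lss. set ls \<subseteq> set atom_list \<and> mset (concat ls) = mset us" "{m..n} \<subseteq> length ` set lss"
    "5 * int m - 4 \<le> wt sw (mset us)" "wt sw (mset us) \<le> 2 * int n + 1"
  shows "tight m n (mset us)"
  unfolding tight_def using assms lens_list by blast

lemma tight_2_3: "tight 2 3 (mset [H,H,H',H',F,F])"
  by (rule tight_list[of "[[[H',H',F], [H,H,F]], [[F,F], [H,H'], [H,H']]]"])
    (auto simp: atom_list_def)

lemma tight_2_4: "tight 2 4 (mset [G,G',H,H',B,B,F,F])"
  by (rule tight_list[of "[[[G,H',B,F], [G',H,B,F]], [[G,H,B], [F,F], [G',H',B]], [[G,G'], [F,F], [H,H'], [B,B]]]"])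
    (auto simp: atom_list_def)

lemma tight_3_6: "tight 3 6 (mset [G,G',H,H,H,H,H',H',H',H',B,B])"
  by (rule tight_list[of "[[[G,H,B], [H,H,H,B,G'], [H',H',H',H']],
     [[G,G'], [H,H,H,H], [B,B], [H',H',H',H']],
     [[G,H,B], [G',H',B], [H,H'], [H,H'], [H,H']],
     [[G,G'], [H,H'], [H,H'], [H,H'], [H,H'], [B,B]]]"])
    (auto simp: atom_list_def)

lemma tight_3_7: "tight 3 7 (mset [G,G,G',G',H,H,H,H',H',H',A,A,B,B])"
  by (rule tight_list[of "[[[G,G,A,B], [H,H,H,B,G'], [H',H',H',A,G']],
     [[G,G'], [G,H,B], [H',H',H',A,G'], [H,H,A,B]],
     [[G,G'], [G,G'], [H',H',A,B], [H,H,A,B], [H,H']],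
     [[G,G'], [G,H,B], [G',H',B], [A,A], [H,H'], [H,H']],
     [[G,G'], [G,G'], [A,A], [H,H'], [H,H'], [H,H'], [B,B]]]"])
    (auto simp: atom_list_def)

lemma tight_4_10: "tight 4 10 (mset [G,G,G',G',H,H,H,H,H,H,H',H',H',H',H',H',A,A,B,B])"
  by (rule tight_list[of "[[[H',H',H',B,G], [H,H,H,A,G], [H,H,H,B,G'], [H',H',H',A,G']],
     [[G,G'], [H',H',H',B,G], [H',H',H',A,G'], [H,H,A,B], [H,H,H,H]],
     [[G,G'], [G,G'], [H',H',A,B], [H,H,A,B], [H,H,H,H], [H',H',H',H']],
     [[G,G'], [G,G'], [H',H',A,B], [H',H',A,B], [H,H'], [H,H'], [H,H,H,H]],
     [[G,G'], [G,G'], [A,A], [H,H'], [H,H'], [H,H,H,H], [B,B], [H',H',H',H']],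
     [[G,G'], [G,H,B], [G',H',B], [A,A], [H,H'], [H,H'], [H,H'], [H,H'], [H,H']],
     [[G,G'], [G,G'], [A,A], [H,H'], [H,H'], [H,H'], [H,H'], [H,H'], [H,H'], [B,B]]]"])
    (auto simp: atom_list_def)

text \<open>The added weight 10 is both 5 times 2 and 2 times 5, so the bounds on the weight
  persist. As 3 is not among the lengths 2, 4, 5 of the new factor, \<open>n + 3\<close> is reached
  as \<open>(n - 1) + 4\<close>; this is where \<open>m < n\<close> enters.\<close>

lemma tight_step:
  assumes S: "tight m n S" and less: "m < n"
  shows "tight (m + 2) (n + 5) (S + bowtie 0 0 0 0)"
proof -
  have b: "2 \<in> lens (bowtie 0 0 0 0)" "4 \<in> lens (bowtie 0 0 0 0)" "5 \<in> lens (bowtie 0 0 0 0)"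
  proof -
    have "mset [G,G,G,A,H] \<in> atoms" "mset [G',G',G',A,H'] \<in> atoms" by (rule atom_listI, simp add: atom_list_def)+
    hence "1 + 1 \<in> lens (mset [G,G,G,A,H] + mset [G',G',G',A,H'])" by (intro lens_add lens_atom)
    thus "2 \<in> lens (bowtie 0 0 0 0)" by (simp add: bowtie_def numeral_2_eq_2)
    show "4 \<in> lens (bowtie 0 0 0 0)" "5 \<in> lens (bowtie 0 0 0 0)"
      using bowtie_mem[of 0 0 0 0 0] bowtie_mem[of 1 0 0 0 0] by simp_all
  qed
  have "i \<in> lens (S + bowtie 0 0 0 0)" if i: "m + 2 \<le> i" "i \<le> n + 5" for i
  proof -
    have sub: "j \<in> lens S" if "m \<le> j" "j \<le> n" for j using S that unfolding tight_def by auto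
    consider "i \<le> n + 2" | "i = n + 3 \<or> i = n + 4" | "i = n + 5" using i by linarith
    thus ?thesis
    proof cases
      case 1
      have "(i - 2) + 2 \<in> lens (S + bowtie 0 0 0 0)"
        by (rule lens_add[OF sub b(1)]) (use 1 i in auto)
      moreover have "(i - 2) + 2 = i" using i by simp
      ultimately show ?thesis by metis
    next
      case 2
      have "(i - 4) + 4 \<in> lens (S + bowtie 0 0 0 0)"
        by (rule lens_add[OF sub b(2)]) (use 2 less in auto)
      moreover have "(i - 4) + 4 = i" using 2 less by auto
      ultimately show ?thesis by metis
    next
      case 3
      have "n + 5 \<in> lens (S + bowtie 0 0 0 0)"
        by (rule lens_add[OF sub b(3)]) (use less in auto)
      thus ?thesis using 3 by simp
    qed
  qed
  moreover have "wt sw (bowtie 0 0 0 0) = 10" by (simp add: bowtie_def)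
  ultimately show ?thesis using S unfolding tight_def by auto
qed

text \<open>The least possible minimum is ceil(2d/3), except that it is 2 for d = 1 and 3 for d = 3.
  A step from \<open>d - 3\<close> to \<open>d\<close> raises the minimum by 2, just as ceil(2d/3)
  grows, but it overshoots when started at the exceptional values; hence d = 4 and d = 6 need their
  own examples.\<close>

lemma tight_minimal:
  "1 \<le> d \<Longrightarrow> \<exists>m S. tight m (m + d) S \<and> 2 \<le> m \<and>
     (\<forall>n. 2 \<le> n \<longrightarrow> 2 * (n + d) \<le> 5 * n \<longrightarrow> \<not> (n = 2 \<and> d = 3) \<longrightarrow> m \<le> n)"
proof (induction d rule: less_induct)
  case (less d)
  consider "d = 1" | "d = 2" | "d = 3" | "d = 4" | "d = 6" | "d = 5 \<or> 7 \<le> d" using less.prems by linarith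
  thus ?case
  proof cases
    case 1 thus ?thesis using tight_2_3 by (intro exI[of _ 2] exI[of _ "mset [H,H,H',H',F,F]"]) simp
  next
    case 2 thus ?thesis using tight_2_4 by (intro exI[of _ 2] exI[of _ "mset [G,G',H,H',B,B,F,F]"]) simp
  next
    case 3 thus ?thesis using tight_3_6 by (intro exI[of _ 3] exI[of _ "mset [G,G',H,H,H,H,H',H',H',H',B,B]"]) auto
  next
    case 4 thus ?thesis using tight_3_7
      by (intro exI[of _ 3] exI[of _ "mset [G,G,G',G',H,H,H,H',H',H',A,A,B,B]"]) auto
  next
    case 5 thus ?thesis using tight_4_10
      by (intro exI[of _ 4] exI[of _ "mset [G,G,G',G',H,H,H,H,H,H,H',H',H',H',H',H',A,A,B,B]"]) auto
  next
    case 6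
    hence "d - 3 < d" "1 \<le> d - 3" by auto
    from less.IH[OF this] obtain m S where m: "tight m (m + (d - 3)) S" "2 \<le> m"
      "\<forall>n. 2 \<le> n \<longrightarrow> 2 * (n + (d - 3)) \<le> 5 * n \<longrightarrow> \<not> (n = 2 \<and> d - 3 = 3) \<longrightarrow> m \<le> n"
      by blast
    have "tight (m + 2) (m + (d - 3) + 5) (S + bowtie 0 0 0 0)" using 6 by (intro tight_step m) auto
    also have "m + (d - 3) + 5 = m + 2 + d" using 6 by auto
    finally have "tight (m + 2) (m + 2 + d) (S + bowtie 0 0 0 0)" .
    moreover have "m + 2 \<le> n" if "2 \<le> n" "2 * (n + d) \<le> 5 * n" for n
    proof -
      have "4 \<le> n" using that 6 by auto
      moreover have "m \<le> n - 2" by (rule m(3)[rule_format]) (use that 6 \<open>4 \<le> n\<close> in auto)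
      ultimately show ?thesis by linarith
    qed
    ultimately show ?thesis by (intro exI[of _ "m + 2"] exI[of _ "S + bowtie 0 0 0 0"]) auto
  qed
qed

lemma realizable_L2:
  assumes "L \<in> \<L>\<^sub>2"
  shows "realizable L"
proof -
  obtain m n where L: "L = {m..n}" "2 \<le> m" "m < n" "2 * n \<le> 5 * m" "\<not> (m = 2 \<and> n = 5)"
    using assms unfolding L2_eq_intervals intervals_def by blast
  have "1 \<le> n - m" using L(3) by simp
  from tight_minimal[OF this] obtain i S where i: "tight i (i + (n - m)) S"
    "\<forall>j. 2 \<le> j \<longrightarrow> 2 * (j + (n - m)) \<le> 5 * j \<longrightarrow> \<not> (j = 2 \<and> n - m = 3) \<longrightarrow> i \<le> j"
    by blast
  have "i \<le> m" by (rule i(2)[rule_format]) (use L in auto)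
  moreover have "realizable {i..i + (n - m)}" using tight_lens[OF i(1)] by blast
  ultimately show ?thesis using realizable_interval_shift[of i "i + (n - m)" "m - i"] L by auto
qed

section \<open>Realization of \<open>\<L>\<^sub>3\<close>, \<open>\<L>\<^sub>4\<close> and
  \<open>\<L>\<^sub>5\<close>\<close>

lemma realizable_L3:
  assumes "L \<in> \<L>\<^sub>3"
  shows "realizable L"
proof -
  obtain m k where L: "L = {m + 2 * i | i. i \<le> k}" "1 \<le> k" "2 * k \<le> m"
    using assms unfolding L3_iff by blast
  \<comment> \<open>Inside \<open>S\<close> the only atoms are \<open>[G, G']\<close> and the two
    fourth powers; their orientation weight is 4 modulo 8, which leaves only even lengths.\<close>
  define S where "S = repeat_mset k (mset [G,G,G,G] + mset [G',G',G',G'])"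
  have cnt: "count S H = 0" "count S H' = 0" "count S A = 0" "count S B = 0" "count S F = 0" "count S Z = 0"
    "count S G = 4 * k" "count S G' = 4 * k" by (simp_all add: S_def)
  have atoms: "\<forall>u\<in>atoms. count u H = 0 \<and> count u H' = 0 \<and> count u A = 0 \<and> count u B = 0 \<and> count u F = 0 \<longrightarrow>
      wt (wpos True True) u mod 8 = 4 \<and> wt sw u \<le> 4"
    unfolding ball_atoms by (simp add: atom_list_def)
  have sub: "wt (wpos True True) u mod 8 = 4 \<and> wt sw u \<le> 4" if "u \<in> atoms" "u \<subseteq># S" for u
    using bspec[OF atoms that(1)] mset_subset_eq_count[OF that(2), of H] mset_subset_eq_count[OF that(2), of H']
      mset_subset_eq_count[OF that(2), of A] mset_subset_eq_count[OF that(2), of B]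
      mset_subset_eq_count[OF that(2), of F] by (simp add: cnt)
  have "lens S = {2 * k + 2 * i | i. i \<le> k}"
  proof (intro equalityI subsetI)
    fix j assume j: "j \<in> lens S"
    have "(wt (wpos True True) S - 4 * int j) mod 8 = 0" by (rule wt_cong[OF _ j]) (use sub in blast)
    hence "even j" unfolding wt_count cnt by simp presburger
    have "wt sw S \<le> int j * 4" by (rule wt_upper[OF _ j]) (use sub in blast)
    hence "2 * k \<le> j" unfolding wt_count cnt by simp
    moreover have "j \<le> 4 * k" using sw_bounds(1)[OF j] unfolding wt_count cnt by simp
    ultimately have "j = 2 * k + 2 * ((j - 2 * k) div 2) \<and> (j - 2 * k) div 2 \<le> k" using \<open>even j\<close> by presburger
    thus "j \<in> {2 * k + 2 * i | i. i \<le> k}" by blast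
  next
    fix j assume "j \<in> {2 * k + 2 * i | i. i \<le> k}"
    then obtain i where i: "j = 2 * k + 2 * i" "i \<le> k" by blast
    hence "i * 4 + (k - i) * 2 = j" by (simp add: algebra_simps)
    thus "j \<in> lens S" using fours_mem[OF i(2)] unfolding S_def by simp
  qed
  hence "lens (replicate_mset (m - 2 * k) Z + S) = {m - 2 * k + (2 * k + 2 * i) | i. i \<le> k}"
    unfolding lens_shift by auto
  also have "\<dots> = L" using L by simp
  finally show ?thesis by blast
qed

lemma realizable_L4:
  assumes "L \<in> \<L>\<^sub>4"
  shows "realizable L"
proof -
  obtain m n where L: "L = {m} \<union> {m + 2..m + 3 + 2 * n}" "2 * n + 2 \<le> m"
    using assms unfolding L4_iff by blast
  have "lens (bowtie n n 0 0) = {n + n + 0 + 0 + 2} \<union> {n + n + 0 + 0 + 2 + 2..n + n + 0 + 0 + 2 + 3 + 2 * min n n}"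
    by (rule bowtie_lens) (use bowtie_gap[of n] in \<open>simp add: eval_nat_numeral mult_2\<close>)
  also have "\<dots> = {2 * n + 2} \<union> {2 * n + 4..4 * n + 5}" by auto
  finally have lens: "lens (bowtie n n 0 0) = {2 * n + 2} \<union> {2 * n + 4..4 * n + 5}" .
  obtain y where m: "m = y + (2 * n + 2)" using L(2) by (metis add.commute le_Suc_ex)
  have "lens (replicate_mset y Z + bowtie n n 0 0) = {y + (2 * n + 2)} \<union> {y + (2 * n + 4)..y + (4 * n + 5)}"
    unfolding lens_shift lens image_Un image_add_atLeastAtMost by (simp add: add.commute)
  also have "\<dots> = L" unfolding L(1) m by auto
  finally show ?thesis by blast
qed

text \<open>The balanced sequence \<open>S\<close> has maximal length 2k + 4. With one atom fewer,
  exactly one atom would have weight 4 and the others size 2. The others form a balanced product, so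
  that atom would be balanced as well, which no atom of weight 4 dividing \<open>S\<close>
  is.\<close>

lemma realizable_L5:
  assumes "L \<in> \<L>\<^sub>5"
  shows "realizable L"
proof -
  obtain m k where L: "L = {m..m + k} \<union> {m + k + 2}" "1 \<le> k" "k + 2 \<le> m"
    using assms unfolding L5_iff by blast
  define S where "S = repeat_mset (2 * k + 2) (mset [G,G']) + repeat_mset 2 (mset [H,H'])"
  have cnt: "count S H = 2" "count S H' = 2" "count S A = 0" "count S B = 0" "count S F = 0" "count S Z = 0"
    "count S G = 2 * k + 2" "count S G' = 2 * k + 2" by (simp_all add: S_def)
  have wS: "wt sw S = 4 * int k + 8" unfolding wt_count cnt by simp
  have bal: "balanced S" by (simp add: balanced_def cnt)
  have atoms: "\<forall>u\<in>atoms. count u A = 0 \<and> count u B = 0 \<and> count u F = 0 \<longrightarrow>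
      wt sw u = 2 \<or> wt sw u = 4 \<and> \<not> balanced u"
    unfolding ball_atoms by (simp add: atom_list_def balanced_def)
  have sub: "wt sw u = 2 \<or> wt sw u = 4 \<and> \<not> balanced u" if "u \<in> atoms" "u \<subseteq># S" for u
    using bspec[OF atoms that(1)] mset_subset_eq_count[OF that(2), of A] mset_subset_eq_count[OF that(2), of B]
      mset_subset_eq_count[OF that(2), of F] by (simp add: cnt)
  have no: "2 * k + 3 \<notin> lens S"
  proof
    assume "2 * k + 3 \<in> lens S"
    then obtain z where z: "set_mset z \<subseteq> atoms" "size z = 2 * k + 3" "\<Sum>\<^sub># z = S" by (auto simp: lens_def)
    have "\<exists>u\<in>#z. wt sw u \<noteq> 2"
    proof (rule ccontr)
      assume "\<not> ?thesis"
      hence "wt sw (\<Sum>\<^sub># z) = 2 * int (size z)" by (induction z) auto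
      thus False using z wS by simp
    qed
    then obtain u where u: "u \<in># z" "wt sw u \<noteq> 2" by blast
    have uS: "u \<in> atoms" "u \<subseteq># S" using u z mset_le_Union[of u z] by auto
    have u4: "wt sw u = 4" "\<not> balanced u" using sub[OF uS] u(2) by auto
    obtain y where y: "z = add_mset u y" using u(1) by (metis insert_DiffM)
    have S: "S = u + \<Sum>\<^sub># y" using z(3) y by simp
    have yat: "set_mset y \<subseteq> atoms" using z(1) y by simp
    have "wt sw S = wt sw u + wt sw (\<Sum>\<^sub># y)" by (subst S) (rule wt_simps(3))
    hence "wt sw (\<Sum>\<^sub># y) = 2 * int (size y)" using z(2) u4(1) wS y by simp
    hence "balanced (\<Sum>\<^sub># y)" using balanced_Union[OF yat minimal_weight_short[OF yat]] by simp
    hence "balanced u" using bal unfolding S by (simp add: balanced_def)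
    thus False using u4(2) by simp
  qed
  have at: "mset [G,G,H,H] \<in> atoms" "mset [G',G',H',H'] \<in> atoms" "mset [G,G,H',H'] \<in> atoms"
    "mset [G',G',G',G'] \<in> atoms" "mset [G,G'] \<in> atoms" "mset [H,H'] \<in> atoms"
    by (rule atom_listI, simp add: atom_list_def)+
  \<comment> \<open>Four copies of \<open>[G, G']\<close> can be regrouped into two fourth powers,
    which lowers the length by 2; \<open>p\<close> counts these regroupings.\<close>
  have pairs: "2 * n - 2 * p \<in> lens (repeat_mset (2 * n) (mset [G,G']))" if "2 * p \<le> n" for n p
  proof -
    have "(0 * 4 + (p - 0) * 2) + (2 * n - 4 * p) * 1 \<in> lens (repeat_mset p (mset [G,G,G,G] + mset [G',G',G',G'])
        + repeat_mset (2 * n - 4 * p) (mset [G,G']))"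
      by (intro lens_add fours_mem lens_repeat[of 1] lens_atom at) simp
    also have "repeat_mset p (mset [G,G,G,G] + mset [G',G',G',G']) + repeat_mset (2 * n - 4 * p) (mset [G,G'])
        = repeat_mset (2 * n) (mset [G,G'])"
      unfolding mset_eq_c24 all_c24 using that by simp
    also have "(0 * 4 + (p - 0) * 2) + (2 * n - 4 * p) * 1 = 2 * n - 2 * p" using that by simp
    finally show ?thesis .
  qed
  have top: "2 * k + 4 \<in> lens S"
  proof -
    obtain n where n: "n \<in> lens S" "2 * int n = wt sw S" using bal by (rule balanced_lens)
    hence "n = 2 * k + 4" using wS by linarith
    thus ?thesis using n(1) by simp
  qed
  have even: "2 * k + 2 - 2 * p \<in> lens S" if "2 * p \<le> k" for p
  proof -
    have "1 + 1 + (2 * k - 2 * p) \<in> lens (mset [G,G,H,H] + mset [G',G',H',H'] + repeat_mset (2 * k) (mset [G,G']))"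
      using that by (intro lens_add lens_atom at pairs) simp
    also have "mset [G,G,H,H] + mset [G',G',H',H'] + repeat_mset (2 * k) (mset [G,G']) = S"
      unfolding mset_eq_c24 all_c24 S_def by simp
    finally show ?thesis using that by (simp add: Suc_diff_le)
  qed
  \<comment> \<open>Odd lengths start from three atoms of size 4, which use up \<open>H\<close> and
    \<open>H'\<close> and four copies each of \<open>G\<close> and \<open>G'\<close>.\<close>
  have odd: "2 * k + 1 - 2 * p \<in> lens S" if "2 * p + 1 \<le> k" for p
  proof -
    have "1 + 1 + 1 + (2 * (k - 1) - 2 * p) \<in> lens (mset [G,G,H,H] + mset [G,G,H',H'] + mset [G',G',G',G']
        + repeat_mset (2 * (k - 1)) (mset [G,G']))"
      using that by (intro lens_add lens_atom at pairs) simp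
    also have "mset [G,G,H,H] + mset [G,G,H',H'] + mset [G',G',G',G'] + repeat_mset (2 * (k - 1)) (mset [G,G']) = S"
      unfolding mset_eq_c24 all_c24 S_def using L(2) by simp
    also have "1 + 1 + 1 + (2 * (k - 1) - 2 * p) = 2 * k + 1 - 2 * p" using that by simp
    finally show ?thesis .
  qed
  have "lens S = {k + 2..2 * k + 2} \<union> {2 * k + 4}"
  proof (intro equalityI subsetI)
    fix j assume j: "j \<in> lens S"
    have "wt sw S \<le> int j * 4" by (rule wt_upper[OF _ j]) (use sub in fastforce)
    hence "k + 2 \<le> j" using wS by simp
    moreover have "j \<le> 2 * k + 4" using sw_bounds(1)[OF j] wS by simp
    moreover have "j \<noteq> 2 * k + 3" using no j by blast
    ultimately show "j \<in> {k + 2..2 * k + 2} \<union> {2 * k + 4}" by auto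
  next
    fix j assume "j \<in> {k + 2..2 * k + 2} \<union> {2 * k + 4}"
    then consider "j = 2 * k + 4" | "k + 2 \<le> j" "j \<le> 2 * k + 2" by auto
    thus "j \<in> lens S"
    proof cases
      case 2
      define p where "p = (2 * k + 2 - j) div 2"
      have "j = 2 * k + 2 - 2 * p \<and> 2 * p \<le> k \<or> j = 2 * k + 1 - 2 * p \<and> 2 * p + 1 \<le> k"
        using 2 unfolding p_def by presburger
      thus ?thesis using even odd by blast
    qed (use top in simp)
  qed
  note lens = this
  obtain y where m: "m = y + (k + 2)" using L(3) by (metis add.commute le_Suc_ex)
  have "lens (replicate_mset y Z + S) = {y + (k + 2)..y + (2 * k + 2)} \<union> {y + (2 * k + 4)}"
    unfolding lens_shift lens image_Un image_add_atLeastAtMost by (simp add: add.commute)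
  also have "\<dots> = L" unfolding L(1) m by auto
  finally show ?thesis by blast
qed

theorem theorem4p5:
  "system_of_sets_of_lengths TYPE(C2_C4) = \<L>\<^sub>1 \<union> \<L>\<^sub>2 \<union> \<L>\<^sub>3 \<union> \<L>\<^sub>4 \<union> \<L>\<^sub>5 \<and>
   \<L>\<^sub>2 = {(y + nat \<lceil>2 * real k / 3\<rceil>) +o {0..k} | y k. k \<ge> 1 \<and> k \<notin> {1, 3}}
      \<union> ({(y + 3) +o {0..3} | y. True} \<union> {(y + 2) +o {0..1} | y. True})"
proof
  show "system_of_sets_of_lengths TYPE(C2_C4) = \<L>\<^sub>1 \<union> \<L>\<^sub>2 \<union> \<L>\<^sub>3 \<union> \<L>\<^sub>4 \<union> \<L>\<^sub>5"
    unfolding system_eq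
  proof (intro equalityI subsetI)
    fix L assume "L \<in> lens ` {S. zs S}"
    thus "L \<in> \<L>\<^sub>1 \<union> \<L>\<^sub>2 \<union> \<L>\<^sub>3 \<union> \<L>\<^sub>4 \<union> \<L>\<^sub>5" using lens_classified by blast
  next
    fix L assume L: "L \<in> \<L>\<^sub>1 \<union> \<L>\<^sub>2 \<union> \<L>\<^sub>3 \<union> \<L>\<^sub>4 \<union> \<L>\<^sub>5"
    hence "realizable L"
      using realizable_singleton realizable_L2 realizable_L3 realizable_L4 realizable_L5
      unfolding \<L>\<^sub>1_def by blast
    then obtain S where S: "lens S = L" by blast
    moreover have "L \<noteq> {}"
      using L unfolding \<L>\<^sub>1_def L2_eq_intervals intervals_def Un_iff L3_iff L4_iff L5_iff by auto
    ultimately have "zs S" using lens_zs by blast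
    thus "L \<in> lens ` {S. zs S}" using S by blast
  qed
qed (unfold L2_eq_intervals L2_alt_eq_intervals, rule refl)

end
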